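(* Let $n\ge1$. If $\varphi:\mathbb{H}^n\to\mathbb{R}$ is an $H$-convex function with round $H$-sections, with constant $K_0\in(0,1)$, then $\varphi$ satisfies the engulfing property $E(H,K)$ for some $K>1$ which depends only on $K_0$.
   Context: Heisenberg group: $\mathbb{H}^n=\mathbb{R}^n\times\mathbb{R}^n\times\mathbb{R}$ with group law $(x,y,t)\circ(x',y',t')=(x+x',y+y',t+t'+2(x'\cdot y-x\cdot y'))$, dilations $\delta_\lambda(x,y,t)=(\lambda x,\lambda y,\lambda^2t)$, and $\mathrm{Pr}_1(x,y,t)=(x,y)\in\mathbb{R}^{2n}$. Gauge norm $N(x,y,t)=((\|x\|^2+\|y\|^2)^2+t^2)^{1/4}$, $d_g(\xi,\xi')=N((\xi')^{-1}\circ\xi)$, $B_g(\xi_0,r)=\{\xi:\ d_g(\xi_0,\xi)\le r\}$. The horizontal plane at $\xi_0=(x_0,y_0,t_0)$ is $H_{\xi_0}=\{(x,y,t):\ t=t_0+2(y_0\cdot x-x_0\cdot y)\}$. $H$-convexity: $\varphi:\mathbb{H}^n\to\mathbb{R}$ is $H$-convex if $\varphi(\xi_1\circ\delta_\lambda(\xi_1^{-1}\circ\xi_2))\le(1-\lambda)\varphi(\xi_1)+\lambda\varphi(\xi_2)$ for all $\xi_1\in\mathbb{H}^n$, $\xi_2\in H_{\xi_1}$, $\lambda\in[0,1]$. Horizontal subdifferential: $\partial_H\varphi(\xi_0)=\{p\in\mathbb{R}^{2n}:\ \varphi(\xi)\ge\varphi(\xi_0)+p\cdot(\mathrm{Pr}_1(\xi)-\mathrm{Pr}_1(\xi_0))\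 \forall\xi\in H_{\xi_0}\}$ (nonempty at every point when $\varphi$ is $H$-convex). $H$-sections: for $\varphi$ $H$-convex, $p_0\in\partial_H\varphi(\xi_0)$, $s>0$, $S_\varphi^H(\xi_0,p_0,s)=\{\xi\in H_{\xi_0}:\ \varphi(\xi)-\varphi(\xi_0)-p_0\cdot(\mathrm{Pr}_1(\xi)-\mathrm{Pr}_1(\xi_0))<s\}$. Round $H$-sections: an $H$-convex $\varphi$ has round $H$-sections with constant $K_0\in(0,1)$ if for every $\xi\in\mathbb{H}^n$, $p\in\partial_H\varphi(\xi)$, $s>0$ there is $R>0$ with $B_g(\xi,K_0R)\cap H_\xi\subset S_\varphi^H(\xi,p,s)\subset B_g(\xi,R)\cap H_\xi$. Engulfing property $E(H,K)$ ($K>1$): for all $\xi\in\mathbb{H}^n$, $p\in\partial_H\varphi(\xi)$, $s>0$, if $\xi'\in S_\varphi^H(\xi,p,s)$ then $S_\varphi^H(\xi,p,s)\cap H_{\xi'}\subset S_\varphi^H(\xi',q,Ks)\cap H_\xi$ for every $q\in\partial_H\varphi(\xi')$. *)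

theory Defs
  imports Complex_Main "Jordan_Normal_Form.Matrix"
begin

text \<open>The dimension \<open>n\<close> is an ordinary natural number, with carrier sets, so that a constant can be
  chosen before \<open>n\<close>. A function on \<open>\<bbbH>\<^sup>n\<close> is a total function of which
  only the values on \<open>heis n\<close> are ever used.\<close>

type_synonym heis_pt = "real vec \<times> real vec \<times> real"

definition heis :: "nat \<Rightarrow> heis_pt set" where
  "heis n = carrier_vec n \<times> carrier_vec n \<times> UNIV"

fun hmult :: "heis_pt \<Rightarrow> heis_pt \<Rightarrow> heis_pt" (infixl \<open>\<circ>\<^sub>H\<close> 70) where
  "(x, y, t) \<circ>\<^sub>H (x', y', t') =
     (x + x', y + y', t + t' + 2 * (scalar_prod x' y - scalar_prod x y'))"

fun hinv :: "heis_pt \<Rightarrow> heis_pt" where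
  "hinv (x, y, t) = (- x, - y, - t)"

fun hdil :: "real \<Rightarrow> heis_pt \<Rightarrow> heis_pt" where
  "hdil l (x, y, t) = (l \<cdot>\<^sub>v x, l \<cdot>\<^sub>v y, l\<^sup>2 * t)"

fun Pr1 :: "heis_pt \<Rightarrow> real vec" where
  "Pr1 (x, y, t) = x @\<^sub>v y"

text \<open>\<open>hmult\<close> is a group law on \<open>heis n\<close> and \<open>hinv\<close> is its inverse.\<close>

definition heis_group :: "nat \<Rightarrow> heis_pt monoid" where
  "heis_group n = \<lparr>carrier = heis n, mult = hmult, one = (0\<^sub>v n, 0\<^sub>v n, 0)\<rparr>"

lemma hinv_closed: "\<xi> \<in> heis n \<Longrightarrow> hinv \<xi> \<in> heis n"
  by (cases \<xi>) (auto simp: heis_def)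

lemma hinv_left: "\<xi> \<in> heis n \<Longrightarrow> hinv \<xi> \<circ>\<^sub>H \<xi> = (0\<^sub>v n, 0\<^sub>v n, 0)"
  by (cases \<xi>) (auto simp: heis_def)

lemma group_heis_group: "group (heis_group n)"
proof (rule groupI)
  fix a b c
  assume "a \<in> carrier (heis_group n)" "b \<in> carrier (heis_group n)" "c \<in> carrier (heis_group n)"
  then show "a \<otimes>\<^bsub>heis_group n\<^esub> b \<otimes>\<^bsub>heis_group n\<^esub> c
    = a \<otimes>\<^bsub>heis_group n\<^esub> (b \<otimes>\<^bsub>heis_group n\<^esub> c)"
    by (cases a; cases b; cases c)
      (auto simp: heis_group_def heis_def add_scalar_prod_distrib[where n=n]
        scalar_prod_add_distrib[where n=n] algebra_simps intro!: assoc_add_vec[where n=n])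
next
  fix a assume "a \<in> carrier (heis_group n)"
  then show "\<exists>b\<in>carrier (heis_group n). b \<otimes>\<^bsub>heis_group n\<^esub> a = \<one>\<^bsub>heis_group n\<^esub>"
    by (intro bexI[of _ "hinv a"]) (simp_all add: heis_group_def hinv_closed hinv_left)
qed (auto simp: heis_group_def heis_def)

lemma inv_heis_group:
  assumes "\<xi> \<in> heis n"
  shows "inv\<^bsub>heis_group n\<^esub> \<xi> = hinv \<xi>"
proof -
  interpret group "heis_group n" by (rule group_heis_group)
  show ?thesis
    by (rule inv_equality)
      (use assms in \<open>simp_all add: heis_group_def hinv_closed hinv_left\<close>)
qed

fun gauge :: "heis_pt \<Rightarrow> real" where
  "gauge (x, y, t) = root 4 ((scalar_prod x x + scalar_prod y y)\<^sup>2 + t\<^sup>2)"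

definition dg :: "heis_pt \<Rightarrow> heis_pt \<Rightarrow> real" where
  "dg \<xi> \<xi>' = gauge (hinv \<xi>' \<circ>\<^sub>H \<xi>)"

definition Bg :: "nat \<Rightarrow> heis_pt \<Rightarrow> real \<Rightarrow> heis_pt set" where
  "Bg n \<xi>0 r = {\<xi> \<in> heis n. dg \<xi> \<xi>0 \<le> r}"

fun hplane :: "nat \<Rightarrow> heis_pt \<Rightarrow> heis_pt set" where
  "hplane n (x0, y0, t0) =
     {(x, y, t). (x, y, t) \<in> heis n \<and> t = t0 + 2 * (scalar_prod y0 x - scalar_prod x0 y)}"

definition H_convex :: "nat \<Rightarrow> (heis_pt \<Rightarrow> real) \<Rightarrow> bool" where
  "H_convex n \<phi> \<longleftrightarrow> (\<forall>\<xi>1\<in>heis n. \<forall>\<xi>2\<in>hplane n \<xi>1. \<forall>l\<in>{0..1}.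
     \<phi> (\<xi>1 \<circ>\<^sub>H hdil l (hinv \<xi>1 \<circ>\<^sub>H \<xi>2)) \<le> (1 - l) * \<phi> \<xi>1 + l * \<phi> \<xi>2)"

definition H_subdiff :: "nat \<Rightarrow> (heis_pt \<Rightarrow> real) \<Rightarrow> heis_pt \<Rightarrow> real vec set" where
  "H_subdiff n \<phi> \<xi>0 = {p \<in> carrier_vec (2 * n).
     \<forall>\<xi>\<in>hplane n \<xi>0. \<phi> \<xi> \<ge> \<phi> \<xi>0 + scalar_prod p (Pr1 \<xi> - Pr1 \<xi>0)}"

definition H_section :: "nat \<Rightarrow> (heis_pt \<Rightarrow> real) \<Rightarrow> heis_pt \<Rightarrow> real vec \<Rightarrow> real \<Rightarrow> heis_pt set" where
  "H_section n \<phi> \<xi>0 p0 s =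
     {\<xi> \<in> hplane n \<xi>0. \<phi> \<xi> - \<phi> \<xi>0 - scalar_prod p0 (Pr1 \<xi> - Pr1 \<xi>0) < s}"

definition round_H_sections :: "nat \<Rightarrow> (heis_pt \<Rightarrow> real) \<Rightarrow> real \<Rightarrow> bool" where
  "round_H_sections n \<phi> K0 \<longleftrightarrow>
     (\<forall>\<xi>\<in>heis n. \<forall>p\<in>H_subdiff n \<phi> \<xi>. \<forall>s>0. \<exists>R>0.
        Bg n \<xi> (K0 * R) \<inter> hplane n \<xi> \<subseteq> H_section n \<phi> \<xi> p s \<and>
        H_section n \<phi> \<xi> p s \<subseteq> Bg n \<xi> R \<inter> hplane n \<xi>)"

definition H_engulfing :: "nat \<Rightarrow> (heis_pt \<Rightarrow> real) \<Rightarrow> real \<Rightarrow> bool" where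
  "H_engulfing n \<phi> K \<longleftrightarrow>
     (\<forall>\<xi>\<in>heis n. \<forall>p\<in>H_subdiff n \<phi> \<xi>. \<forall>s>0. \<forall>\<xi>'\<in>H_section n \<phi> \<xi> p s.
        \<forall>q\<in>H_subdiff n \<phi> \<xi>'.
          H_section n \<phi> \<xi> p s \<inter> hplane n \<xi>' \<subseteq> H_section n \<phi> \<xi>' q (K * s) \<inter> hplane n \<xi>)"

end

theory Submission
  imports Defs "HOL-Analysis.Elementary_Metric_Spaces"
begin

text \<open>After a left translation and subtraction of an affine function we may take \<open>\<xi>\<close> to be the origin,
  \<open>p = 0\<close>, \<open>\<phi>(\<xi>) = 0\<close>, so that \<open>\<phi> \<ge> 0\<close> on the plane \<open>t = 0\<close>. If \<open>\<xi>'\<close> and \<open>\<eta>\<close> lie in the section of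
  height \<open>s\<close> and are horizontally related, the subgradient inequality at \<open>\<xi>'\<close> for the reflection
  \<open>2\<xi>' - \<eta>\<close> reduces engulfing to \<open>\<phi>(2\<xi>' - \<eta>) < C s\<close>, i.e. to the inclusion of the ball of radius \<open>3R\<close> in the
  section of height \<open>C s\<close>, where \<open>R\<close> is the outer radius of the section of height \<open>s\<close>. By roundness it
  suffices that this larger section contains one point far out on one fixed horizontal ray.

  Growth on that ray is controlled by roundness at an intermediate point: a section centred at \<open>c\<close> that
  reaches back to the origin reaches forward to \<open>(1 + K\<^sub>0) c\<close>, which gives
  \<open>\<phi>(\<lambda>r) \<le> C\<^sub>1 \<phi>(r)\<close> with \<open>\<lambda> > 1\<close>. This needs a subgradient at \<open>c\<close>. Roundness at the origin bounds
  \<open>\<phi>\<close> on the plane \<open>t = 0\<close>, and \<open>H\<close>-convexity spreads the bound to all bounded sets, so \<open>\<phi>\<close> is continuous.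
  Local minimum points of \<open>\<phi>\<close> plus a steep quadratic then form a dense set of points with a subgradient,
  and the growth inequality involves only values of \<open>\<phi>\<close>, so it passes to the limit.\<close>

section \<open>Horizontal lines\<close>

text \<open>With \<open>a = x' - x\<close> and \<open>b = y' - y\<close> the terms in x . y cancel
  from the last coordinate of the product and leave the equation of the plane. The pair
  \<open>(a, b)\<close> serves as the coordinate on the plane from here on.\<close>

lemma hplane_conv:
  assumes "\<xi> \<in> heis n"
  shows "hplane n \<xi> = {\<xi> \<circ>\<^sub>H (a, b, 0) | a b. a \<in> carrier_vec n \<and> b \<in> carrier_vec n}"
proof -
  obtain x y t where \<xi>: "\<xi> = (x, y, t)" by (cases \<xi>)
  then have c: "x \<in> carrier_vec n" "y \<in> carrier_vec n" using assms by (auto simp: heis_def)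
  show ?thesis
  proof (intro equalityI subsetI)
    fix \<eta> assume "\<eta> \<in> hplane n \<xi>"
    moreover obtain x' y' t' where \<eta>: "\<eta> = (x', y', t')" by (cases \<eta>)
    ultimately have *: "(x', y', t') \<in> hplane n \<xi>" by simp
    then have c': "x' \<in> carrier_vec n" "y' \<in> carrier_vec n" by (auto simp: \<xi> heis_def)
    then have "(x', y', t') = \<xi> \<circ>\<^sub>H (x' - x, y' - y, 0)"
      using * c by (auto simp: \<xi> minus_scalar_prod_distrib[where n=n] scalar_prod_minus_distrib[where n=n] comm_scalar_prod[of _ n y]
          intro!: eq_vecI)
    then show "\<eta> \<in> {\<xi> \<circ>\<^sub>H (a, b, 0) | a b. a \<in> carrier_vec n \<and> b \<in> carrier_vec n}"
      using c c' \<eta> by (metis (mono_tags, lifting) mem_Collect_eq minus_carrier_vec)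
  next
    fix \<eta> assume "\<eta> \<in> {\<xi> \<circ>\<^sub>H (a, b, 0) | a b. a \<in> carrier_vec n \<and> b \<in> carrier_vec n}"
    then show "\<eta> \<in> hplane n \<xi>"
      using c by (auto simp add: \<xi> heis_def scalar_prod_add_distrib[where n=n] comm_scalar_prod[of y n x] comm_scalar_prod[of y n])
  qed
qed

lemma hmult_closed: "\<xi> \<in> heis n \<Longrightarrow> \<eta> \<in> heis n \<Longrightarrow> \<xi> \<circ>\<^sub>H \<eta> \<in> heis n"
  by (cases \<xi>; cases \<eta>) (auto simp: heis_def)

lemma hmult_assoc:
  "\<xi> \<in> heis n \<Longrightarrow> \<eta> \<in> heis n \<Longrightarrow> \<zeta> \<in> heis n \<Longrightarrow> \<xi> \<circ>\<^sub>H \<eta> \<circ>\<^sub>H \<zeta> = \<xi> \<circ>\<^sub>H (\<eta> \<circ>\<^sub>H \<zeta>)"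
  using group.is_monoid[OF group_heis_group[of n]] monoid.m_assoc[of "heis_group n"]
  by (fastforce simp: heis_group_def)

lemma hinv_mult_cancel: "\<xi> \<in> heis n \<Longrightarrow> \<eta> \<in> heis n \<Longrightarrow> hinv \<xi> \<circ>\<^sub>H (\<xi> \<circ>\<^sub>H \<eta>) = \<eta>"
proof -
  assume *: "\<xi> \<in> heis n" "\<eta> \<in> heis n"
  then have "hinv \<xi> \<circ>\<^sub>H (\<xi> \<circ>\<^sub>H \<eta>) = (hinv \<xi> \<circ>\<^sub>H \<xi>) \<circ>\<^sub>H \<eta>"
    by (simp add: hmult_assoc[of _ n] hinv_closed)
  also have "\<dots> = \<eta>" using * by (cases \<eta>) (auto simp: hinv_left[where n=n] heis_def)
  finally show ?thesis .
qed

lemma hmult_inv_cancel: "\<xi> \<in> heis n \<Longrightarrow> \<eta> \<in> heis n \<Longrightarrow> \<xi> \<circ>\<^sub>H (hinv \<xi> \<circ>\<^sub>H \<eta>) = \<eta>"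
  using hinv_mult_cancel[of "hinv \<xi>" n \<eta>] hinv_closed[of \<xi> n] by (cases \<xi>) (auto simp: heis_def)

text \<open>Parallel horizontal displacements produce no vertical term, since the two scalar
  products in the group law are equal.\<close>

lemma hmult_horizontal:
  assumes "\<xi> \<in> heis n" "a \<in> carrier_vec n" "b \<in> carrier_vec n"
  shows "\<xi> \<circ>\<^sub>H (s \<cdot>\<^sub>v a, s \<cdot>\<^sub>v b, 0) \<circ>\<^sub>H (t \<cdot>\<^sub>v a, t \<cdot>\<^sub>v b, 0) = \<xi> \<circ>\<^sub>H ((s + t) \<cdot>\<^sub>v a, (s + t) \<cdot>\<^sub>v b, 0)"
proof -
  have "(s \<cdot>\<^sub>v a, s \<cdot>\<^sub>v b, 0) \<in> heis n" "(t \<cdot>\<^sub>v a, t \<cdot>\<^sub>v b, 0) \<in> heis n"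
    using assms by (auto simp: heis_def)
  from hmult_assoc[OF assms(1) this] show ?thesis
    using assms by (simp add: add_smult_distrib_vec)
qed

lemma hplane_iff:
  "\<xi> \<in> heis n \<Longrightarrow> \<eta> \<in> hplane n \<xi> \<longleftrightarrow> (\<exists>a\<in>carrier_vec n. \<exists>b\<in>carrier_vec n. \<eta> = \<xi> \<circ>\<^sub>H (a, b, 0))"
  unfolding hplane_conv by blast

lemma ball_hplane:
  "\<xi> \<in> heis n \<Longrightarrow> (\<forall>\<eta>\<in>hplane n \<xi>. P \<eta>) \<longleftrightarrow> (\<forall>a\<in>carrier_vec n. \<forall>b\<in>carrier_vec n. P (\<xi> \<circ>\<^sub>H (a, b, 0)))"
  unfolding hplane_conv by blast

text \<open>A dilation acts on a displacement of height 0 as a scaling, so H-convexity is ordinary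
  convexity along horizontal lines.\<close>

lemma H_convex_iff:
  "H_convex n \<phi> \<longleftrightarrow> (\<forall>\<xi>\<in>heis n. \<forall>a\<in>carrier_vec n. \<forall>b\<in>carrier_vec n. \<forall>l\<in>{0..1}.
     \<phi> (\<xi> \<circ>\<^sub>H (l \<cdot>\<^sub>v a, l \<cdot>\<^sub>v b, 0)) \<le> (1 - l) * \<phi> \<xi> + l * \<phi> (\<xi> \<circ>\<^sub>H (a, b, 0)))"
proof -
  have "hdil l (hinv \<xi> \<circ>\<^sub>H (\<xi> \<circ>\<^sub>H (a, b, 0))) = (l \<cdot>\<^sub>v a, l \<cdot>\<^sub>v b, 0)"
    if "\<xi> \<in> heis n" "a \<in> carrier_vec n" "b \<in> carrier_vec n" for \<xi> a b l
    using that by (subst hinv_mult_cancel[of _ n]) (auto simp: heis_def)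
  then show ?thesis unfolding H_convex_def by (simp add: ball_hplane del: hmult.simps cong: ball_cong)
qed

lemma hconvex_line:
  assumes "H_convex n \<phi>" "\<xi> \<in> heis n" "a \<in> carrier_vec n" "b \<in> carrier_vec n" "0 \<le> l" "l \<le> 1"
  shows "\<phi> (\<xi> \<circ>\<^sub>H (l \<cdot>\<^sub>v a, l \<cdot>\<^sub>v b, 0)) \<le> (1 - l) * \<phi> \<xi> + l * \<phi> (\<xi> \<circ>\<^sub>H (a, b, 0))"
  using assms unfolding H_convex_iff by simp

lemma Pr1_horizontal:
  assumes "\<xi> \<in> heis n" "a \<in> carrier_vec n" "b \<in> carrier_vec n"
  shows "Pr1 (\<xi> \<circ>\<^sub>H (a, b, 0)) - Pr1 \<xi> = a @\<^sub>v b"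
  using assms by (cases \<xi>) (auto simp: heis_def intro!: eq_vecI)

lemma H_subdiff_iff:
  assumes "\<xi> \<in> heis n"
  shows "p \<in> H_subdiff n \<phi> \<xi> \<longleftrightarrow> p \<in> carrier_vec (2 * n) \<and>
    (\<forall>a\<in>carrier_vec n. \<forall>b\<in>carrier_vec n. \<phi> \<xi> + scalar_prod p (a @\<^sub>v b) \<le> \<phi> (\<xi> \<circ>\<^sub>H (a, b, 0)))"
  by (simp add: H_subdiff_def ball_hplane[OF assms] Pr1_horizontal[OF assms] del: hmult.simps cong: ball_cong)

lemma H_section_iff:
  assumes "\<xi> \<in> heis n" "a \<in> carrier_vec n" "b \<in> carrier_vec n"
  shows "\<xi> \<circ>\<^sub>H (a, b, 0) \<in> H_section n \<phi> \<xi> p s \<longleftrightarrow>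
    \<phi> (\<xi> \<circ>\<^sub>H (a, b, 0)) - \<phi> \<xi> - scalar_prod p (a @\<^sub>v b) < s"
proof -
  have "\<xi> \<circ>\<^sub>H (a, b, 0) \<in> hplane n \<xi>" using assms by (auto simp only: hplane_iff)
  then show ?thesis by (simp add: H_section_def Pr1_horizontal[OF assms] del: hmult.simps)
qed

text \<open>The displacement has height 0, where the gauge norm is Euclidean. Roundness therefore
  compares sections with Euclidean balls in the coordinates \<open>(a, b)\<close>.\<close>

lemma dg_horizontal:
  assumes "\<xi> \<in> heis n" "a \<in> carrier_vec n" "b \<in> carrier_vec n"
  shows "dg (\<xi> \<circ>\<^sub>H (a, b, 0)) \<xi> = sqrt (scalar_prod a a + scalar_prod b b)"
proof -
  have "hinv \<xi> \<circ>\<^sub>H (\<xi> \<circ>\<^sub>H (a, b, 0)) = (a, b, 0)"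
    using assms by (intro hinv_mult_cancel[of _ n]) (auto simp: heis_def)
  moreover have "root 4 ((scalar_prod a a + scalar_prod b b)\<^sup>2) = sqrt (scalar_prod a a + scalar_prod b b)"
  proof -
    have "root 4 z = sqrt (sqrt z)" for z :: real
      using real_root_mult_exp[of 2 2 z] by (simp add: sqrt_def)
    moreover have "0 \<le> scalar_prod a a + scalar_prod b b"
      by (simp add: scalar_prod_def sum_nonneg)
    ultimately show ?thesis by simp
  qed
  ultimately show ?thesis by (simp add: dg_def)
qed

lemma horizontal_cancel:
  assumes "\<xi> \<in> heis n" "\<eta> \<in> heis n" "\<zeta> \<in> heis n"
  shows "\<xi> \<circ>\<^sub>H \<eta> = \<xi> \<circ>\<^sub>H \<zeta> \<longleftrightarrow> \<eta> = \<zeta>"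
  using assms by (metis hinv_mult_cancel)

text \<open>Every later use of roundness goes through this form, free of planes and gauge
  balls.\<close>

lemma round_H_sections_iff:
  "round_H_sections n \<phi> K \<longleftrightarrow> (\<forall>\<xi>\<in>heis n. \<forall>p\<in>H_subdiff n \<phi> \<xi>. \<forall>s>0. \<exists>R>0.
     \<forall>a\<in>carrier_vec n. \<forall>b\<in>carrier_vec n.
       (sqrt (scalar_prod a a + scalar_prod b b) \<le> K * R \<longrightarrow> \<phi> (\<xi> \<circ>\<^sub>H (a, b, 0)) - \<phi> \<xi> - scalar_prod p (a @\<^sub>v b) < s) \<and>
       (\<phi> (\<xi> \<circ>\<^sub>H (a, b, 0)) - \<phi> \<xi> - scalar_prod p (a @\<^sub>v b) < s \<longrightarrow> sqrt (scalar_prod a a + scalar_prod b b) \<le> R))"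
proof -
  have "(Bg n \<xi> (K * R) \<inter> hplane n \<xi> \<subseteq> H_section n \<phi> \<xi> p s \<and> H_section n \<phi> \<xi> p s \<subseteq> Bg n \<xi> R \<inter> hplane n \<xi>) \<longleftrightarrow>
     (\<forall>a\<in>carrier_vec n. \<forall>b\<in>carrier_vec n.
       (sqrt (scalar_prod a a + scalar_prod b b) \<le> K * R \<longrightarrow> \<phi> (\<xi> \<circ>\<^sub>H (a, b, 0)) - \<phi> \<xi> - scalar_prod p (a @\<^sub>v b) < s) \<and>
       (\<phi> (\<xi> \<circ>\<^sub>H (a, b, 0)) - \<phi> \<xi> - scalar_prod p (a @\<^sub>v b) < s \<longrightarrow> sqrt (scalar_prod a a + scalar_prod b b) \<le> R))"
    if \<xi>: "\<xi> \<in> heis n" for \<xi> p s R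
  proof -
    have ball: "\<xi> \<circ>\<^sub>H (a, b, 0) \<in> Bg n \<xi> r \<longleftrightarrow> sqrt (scalar_prod a a + scalar_prod b b) \<le> r"
      if "a \<in> carrier_vec n" "b \<in> carrier_vec n" for a b r
    proof -
      have "\<xi> \<circ>\<^sub>H (a, b, 0) \<in> heis n" using that by (intro hmult_closed \<xi>) (auto simp: heis_def)
      then show ?thesis by (simp add: Bg_def dg_horizontal[OF \<xi> that])
    qed
    have "H_section n \<phi> \<xi> p s \<subseteq> hplane n \<xi>" by (auto simp: H_section_def)
    then have "(Bg n \<xi> (K * R) \<inter> hplane n \<xi> \<subseteq> H_section n \<phi> \<xi> p s \<and> H_section n \<phi> \<xi> p s \<subseteq> Bg n \<xi> R \<inter> hplane n \<xi>) \<longleftrightarrow>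
      (\<forall>\<eta>\<in>hplane n \<xi>. (\<eta> \<in> Bg n \<xi> (K * R) \<longrightarrow> \<eta> \<in> H_section n \<phi> \<xi> p s) \<and> (\<eta> \<in> H_section n \<phi> \<xi> p s \<longrightarrow> \<eta> \<in> Bg n \<xi> R))"
      by blast
    also note ball_hplane[OF \<xi>]
    finally show ?thesis by (simp add: ball H_section_iff[OF \<xi>] del: hmult.simps cong: ball_cong)
  qed
  then show ?thesis unfolding round_H_sections_def by (simp cong: ball_cong)
qed

lemma hconvex_le_max:
  assumes H: "H_convex n \<phi>" and \<xi>: "\<xi> \<in> heis n" and ab: "a \<in> carrier_vec n" "b \<in> carrier_vec n"
    and \<mu>: "0 \<le> \<mu>" and \<nu>: "0 \<le> \<nu>"
  shows "\<phi> \<xi> \<le> max (\<phi> (\<xi> \<circ>\<^sub>H ((- \<mu>) \<cdot>\<^sub>v a, (- \<mu>) \<cdot>\<^sub>v b, 0))) (\<phi> (\<xi> \<circ>\<^sub>H (\<nu> \<cdot>\<^sub>v a, \<nu> \<cdot>\<^sub>v b, 0)))"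
proof (cases "\<mu> + \<nu> = 0")
  case True
  then have "\<mu> = 0" "\<nu> = 0" using \<mu> \<nu> by auto
  moreover have "\<xi> \<circ>\<^sub>H (0 \<cdot>\<^sub>v a, 0 \<cdot>\<^sub>v b, 0) = \<xi>" using \<xi> ab by (cases \<xi>) (auto simp: heis_def intro!: eq_vecI)
  ultimately show ?thesis by simp
next
  case False
  then have pos: "\<mu> + \<nu> > 0" using \<mu> \<nu> by auto
  \<comment> \<open>The fraction of the segment starting at \<open>?A\<close> after which
    \<open>\<xi>\<close> is reached.\<close>
  define l where "l = \<mu> / (\<mu> + \<nu>)"
  have l: "0 \<le> l" "l \<le> 1" using \<mu> \<nu> pos by (auto simp: l_def field_simps)
  let ?A = "\<xi> \<circ>\<^sub>H ((- \<mu>) \<cdot>\<^sub>v a, (- \<mu>) \<cdot>\<^sub>v b, 0)"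
  have A: "?A \<in> heis n" using \<xi> ab by (intro hmult_closed) (auto simp: heis_def)
  let ?a = "(\<mu> + \<nu>) \<cdot>\<^sub>v a" and ?b = "(\<mu> + \<nu>) \<cdot>\<^sub>v b"
  have "\<phi> (?A \<circ>\<^sub>H (l \<cdot>\<^sub>v ?a, l \<cdot>\<^sub>v ?b, 0)) \<le> (1 - l) * \<phi> ?A + l * \<phi> (?A \<circ>\<^sub>H (?a, ?b, 0))"
    using ab by (intro hconvex_line[OF H A]) (auto simp: l)
  moreover have "?A \<circ>\<^sub>H (l \<cdot>\<^sub>v ?a, l \<cdot>\<^sub>v ?b, 0) = \<xi>"
  proof -
    have "?A \<circ>\<^sub>H (l \<cdot>\<^sub>v ?a, l \<cdot>\<^sub>v ?b, 0) = ?A \<circ>\<^sub>H (\<mu> \<cdot>\<^sub>v a, \<mu> \<cdot>\<^sub>v b, 0)"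
      using pos by (simp add: smult_smult_assoc l_def)
    also have "\<dots> = \<xi> \<circ>\<^sub>H (0 \<cdot>\<^sub>v a, 0 \<cdot>\<^sub>v b, 0)" using hmult_horizontal[OF \<xi> ab, of "-\<mu>" \<mu>] by simp
    also have "\<dots> = \<xi>" using \<xi> ab by (cases \<xi>) (auto simp: heis_def intro!: eq_vecI)
    finally show ?thesis .
  qed
  moreover have "?A \<circ>\<^sub>H (?a, ?b, 0) = \<xi> \<circ>\<^sub>H (\<nu> \<cdot>\<^sub>v a, \<nu> \<cdot>\<^sub>v b, 0)"
    using hmult_horizontal[OF \<xi> ab, of "-\<mu>" "\<mu>+\<nu>"] by simp
  ultimately have "\<phi> \<xi> \<le> (1 - l) * \<phi> ?A + l * \<phi> (\<xi> \<circ>\<^sub>H (\<nu> \<cdot>\<^sub>v a, \<nu> \<cdot>\<^sub>v b, 0))" by simp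
  also have "\<dots> \<le> max (\<phi> ?A) (\<phi> (\<xi> \<circ>\<^sub>H (\<nu> \<cdot>\<^sub>v a, \<nu> \<cdot>\<^sub>v b, 0)))"
    using convex_bound_le[of "\<phi> ?A" "max (\<phi> ?A) (\<phi> (\<xi> \<circ>\<^sub>H (\<nu> \<cdot>\<^sub>v a, \<nu> \<cdot>\<^sub>v b, 0)))" "\<phi> (\<xi> \<circ>\<^sub>H (\<nu> \<cdot>\<^sub>v a, \<nu> \<cdot>\<^sub>v b, 0))" "1-l" l] l
    by simp
  finally show ?thesis .
qed

section \<open>Coordinate boxes\<close>

text \<open>The height is bounded by \<open>r\<close> and not by its square: boxes only express
  boundedness and are never dilated.\<close>

definition hbox :: "nat \<Rightarrow> real \<Rightarrow> heis_pt set" where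
  "hbox n r = {(x, y, t). (x, y, t) \<in> heis n \<and> (\<forall>i<n. \<bar>x $ i\<bar> \<le> r \<and> \<bar>y $ i\<bar> \<le> r) \<and> \<bar>t\<bar> \<le> r}"

lemma hbox_heis: "\<xi> \<in> hbox n r \<Longrightarrow> \<xi> \<in> heis n"
  by (auto simp: hbox_def)

lemma hbox_mono: "r \<le> r' \<Longrightarrow> hbox n r \<subseteq> hbox n r'"
  by (fastforce simp: hbox_def)

lemma scalar_prod_abs_le:
  fixes x y :: "real vec"
  assumes "x \<in> carrier_vec n" "y \<in> carrier_vec n" "\<forall>i<n. \<bar>x $ i\<bar> \<le> r" "\<forall>i<n. \<bar>y $ i\<bar> \<le> s"
  shows "\<bar>scalar_prod x y\<bar> \<le> n * (r * s)"
proof -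
  have "\<bar>scalar_prod x y\<bar> \<le> (\<Sum>i<n. \<bar>x $ i * y $ i\<bar>)"
    using assms by (simp add: scalar_prod_def sum_abs lessThan_atLeast0)
  also have "\<dots> \<le> (\<Sum>i<n. r * s)"
    using assms by (intro sum_mono) (auto simp: abs_mult intro!: mult_mono order_trans[OF abs_ge_zero])
  finally show ?thesis by simp
qed

text \<open>The term \<open>4 * real n * (r * s)\<close> bounds twice the difference of the two
  scalar products in the group law.\<close>

lemma hmult_hbox:
  assumes "\<xi> \<in> hbox n r" "\<eta> \<in> hbox n s"
  shows "\<xi> \<circ>\<^sub>H \<eta> \<in> hbox n (r + s + 4 * real n * (r * s))"
proof -
  obtain x y t x' y' t' where e: "\<xi> = (x, y, t)" "\<eta> = (x', y', t')" by (cases \<xi>; cases \<eta>)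
  have c: "x \<in> carrier_vec n" "y \<in> carrier_vec n" "x' \<in> carrier_vec n" "y' \<in> carrier_vec n"
    using assms by (auto simp: e hbox_def heis_def)
  have rs: "0 \<le> r" "0 \<le> s" using assms by (auto simp: e hbox_def)
  have 1: "\<bar>scalar_prod x' y\<bar> \<le> n * (s * r)" "\<bar>scalar_prod x y'\<bar> \<le> n * (r * s)"
    using assms c by (auto intro!: scalar_prod_abs_le simp: e hbox_def)
  have 2: "\<bar>t\<bar> \<le> r" "\<bar>t'\<bar> \<le> s" using assms by (auto simp: e hbox_def)
  have "\<bar>t + t' + 2 * (scalar_prod x' y - scalar_prod x y')\<bar> \<le> r + s + 4 * real n * (r * s)"
    using 1 2 by (simp add: mult.commute[of s r])
  moreover have "\<bar>x $ i + x' $ i\<bar> \<le> r + s + 4 * real n * (r * s)" "\<bar>y $ i + y' $ i\<bar> \<le> r + s + 4 * real n * (r * s)" if "i < n" for i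
  proof -
    have "0 \<le> 4 * real n * (r * s)" using rs by simp
    moreover have "\<bar>x $ i\<bar> \<le> r" "\<bar>x' $ i\<bar> \<le> s" "\<bar>y $ i\<bar> \<le> r" "\<bar>y' $ i\<bar> \<le> s"
      using assms that by (auto simp: e hbox_def)
    ultimately show "\<bar>x $ i + x' $ i\<bar> \<le> r + s + 4 * real n * (r * s)" "\<bar>y $ i + y' $ i\<bar> \<le> r + s + 4 * real n * (r * s)"
      by linarith+
  qed
  ultimately show ?thesis using c by (auto simp: e hbox_def heis_def)
qed

section \<open>Local boundedness\<close>

text \<open>The normalised situation. \<open>phi_nonneg\<close> makes the zero vector a subgradient
  at the origin, so the sections there are sublevel sets on the plane of height 0.\<close>

locale round_at_origin =
  fixes n :: nat and \<phi> :: "heis_pt \<Rightarrow> real" and K0 :: real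
  assumes n_pos: "1 \<le> n"
    and K0_pos: "0 < K0"
    and convex: "H_convex n \<phi>"
    and round: "round_H_sections n \<phi> K0"
    and phi_origin: "\<phi> (0\<^sub>v n, 0\<^sub>v n, 0) = 0"
    and phi_nonneg: "\<And>x y. x \<in> carrier_vec n \<Longrightarrow> y \<in> carrier_vec n \<Longrightarrow> 0 \<le> \<phi> (x, y, 0)"
begin

abbreviation "e \<equiv> unit_vec n 0 :: real vec"

lemma origin_heis: "(0\<^sub>v n, 0\<^sub>v n, 0) \<in> heis n"
  by (simp add: heis_def)

lemma round_origin:
  assumes "s > 0"
  obtains R where "R > 0"
    "\<And>x y. x \<in> carrier_vec n \<Longrightarrow> y \<in> carrier_vec n \<Longrightarrow> sqrt (scalar_prod x x + scalar_prod y y) \<le> K0 * R \<Longrightarrow> \<phi> (x, y, 0) < s"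
    "\<And>x y. x \<in> carrier_vec n \<Longrightarrow> y \<in> carrier_vec n \<Longrightarrow> \<phi> (x, y, 0) < s \<Longrightarrow> sqrt (scalar_prod x x + scalar_prod y y) \<le> R"
proof -
  have 1: "scalar_prod (0\<^sub>v (2 * n)) (a @\<^sub>v b) = (0::real)" if "a \<in> carrier_vec n" "b \<in> carrier_vec n" for a b
    using append_carrier_vec[OF that] by (simp add: mult_2)
  have 2: "(0\<^sub>v n, 0\<^sub>v n, 0) \<circ>\<^sub>H (a, b, 0) = (a, b, 0)" if "a \<in> carrier_vec n" "b \<in> carrier_vec n" for a b
    using that by simp
  have "0\<^sub>v (2 * n) \<in> H_subdiff n \<phi> (0\<^sub>v n, 0\<^sub>v n, 0)"
    by (simp add: H_subdiff_iff origin_heis 1 2 phi_origin phi_nonneg del: hmult.simps)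
  then obtain R where "R > 0" "\<And>x y. x \<in> carrier_vec n \<Longrightarrow> y \<in> carrier_vec n \<Longrightarrow>
      (sqrt (scalar_prod x x + scalar_prod y y) \<le> K0 * R \<longrightarrow> \<phi> (x, y, 0) < s) \<and>
      (\<phi> (x, y, 0) < s \<longrightarrow> sqrt (scalar_prod x x + scalar_prod y y) \<le> R)"
    using round[unfolded round_H_sections_iff, rule_format, OF origin_heis _ assms]
    unfolding phi_origin by (metis 1 2 diff_zero)
  then show ?thesis using that by blast
qed

text \<open>A section that contains a point at distance \<open>d\<close> from the origin has outer
  radius at least \<open>d\<close>, hence contains the ball of radius \<open>K0 * d\<close>.\<close>

lemma bounded_above_plane: "\<exists>M. \<forall>x y. (x, y, 0) \<in> hbox n r \<longrightarrow> \<phi> (x, y, 0) \<le> M"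
proof (cases "r \<ge> 0")
  case False
  then show ?thesis by (auto simp: hbox_def)
next
  case True
  \<comment> \<open>Chosen so that \<open>K0 * d\<close> is the Euclidean radius of the box.\<close>
  define d where "d = sqrt (n * (r * r) + n * (r * r)) / K0"
  have d: "d \<ge> 0" "K0 * d = sqrt (n * (r * r) + n * (r * r))" using K0_pos True by (auto simp: d_def)
  \<comment> \<open>The summand 1 makes the height positive and puts the point strictly inside the
    section.\<close>
  define s where "s = \<phi> (d \<cdot>\<^sub>v e, 0\<^sub>v n, 0) + 1"
  have "s > 0" using phi_nonneg[of "d \<cdot>\<^sub>v e" "0\<^sub>v n"] by (simp add: s_def)
  then obtain R where R: "R > 0"
    and 1: "\<And>x y. x \<in> carrier_vec n \<Longrightarrow> y \<in> carrier_vec n \<Longrightarrow> sqrt (scalar_prod x x + scalar_prod y y) \<le> K0 * R \<Longrightarrow> \<phi> (x, y, 0) < s"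
    and 2: "\<And>x y. x \<in> carrier_vec n \<Longrightarrow> y \<in> carrier_vec n \<Longrightarrow> \<phi> (x, y, 0) < s \<Longrightarrow> sqrt (scalar_prod x x + scalar_prod y y) \<le> R"
    by (rule round_origin) blast
  have "sqrt (scalar_prod (d \<cdot>\<^sub>v e) (d \<cdot>\<^sub>v e) + scalar_prod (0\<^sub>v n) (0\<^sub>v n)) \<le> R"
    by (rule 2) (auto simp: s_def)
  then have "d \<le> R" using d n_pos by (simp flip: power2_eq_square)
  then have KR: "sqrt (n * (r * r) + n * (r * r)) \<le> K0 * R" using d(2) K0_pos by (metis mult_left_mono less_imp_le)
  have "\<phi> (x, y, 0) \<le> s" if "(x, y, 0) \<in> hbox n r" for x y
  proof -
    have c: "x \<in> carrier_vec n" "y \<in> carrier_vec n" using that by (auto simp: hbox_def heis_def)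
    have "\<bar>scalar_prod x x\<bar> \<le> n * (r * r)" "\<bar>scalar_prod y y\<bar> \<le> n * (r * r)"
      using that c by (auto intro!: scalar_prod_abs_le simp: hbox_def)
    then have "sqrt (scalar_prod x x + scalar_prod y y) \<le> sqrt (n * (r * r) + n * (r * r))"
      by (intro real_sqrt_le_mono) linarith
    also note KR
    finally show ?thesis using 1[OF c] by simp
  qed
  then show ?thesis by blast
qed

text \<open>These points form a horizontal line with direction
  \<open>\<alpha> \<cdot>\<^sub>v e\<close>: a step \<open>l\<close> raises the height by
  \<open>2 * (l * \<alpha>) * (1 / \<alpha>) = 2 * l\<close>. By convexity the values at the two
  ends bound the segment.\<close>

lemma bounded_above_line:
  assumes "\<alpha> \<noteq> 0" "S \<ge> 0"
  shows "\<exists>M. \<forall>s. \<bar>s\<bar> \<le> S \<longrightarrow> \<phi> ((\<alpha> * s) \<cdot>\<^sub>v e, (1 / \<alpha>) \<cdot>\<^sub>v e, 2 * s) \<le> M"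
proof -
  let ?B = "\<lambda>s. ((\<alpha> * s) \<cdot>\<^sub>v e, (1 / \<alpha>) \<cdot>\<^sub>v e, 2 * s) :: heis_pt"
  have step: "?B s \<circ>\<^sub>H (l \<cdot>\<^sub>v (\<alpha> \<cdot>\<^sub>v e), l \<cdot>\<^sub>v 0\<^sub>v n, 0) = ?B (s + l)" for s l
    using assms n_pos by (auto intro!: eq_vecI simp: algebra_simps)
  have "\<phi> (?B s) \<le> max (\<phi> (?B (- S))) (\<phi> (?B S))" if "\<bar>s\<bar> \<le> S" for s
    using hconvex_le_max[OF convex, of "?B s" "\<alpha> \<cdot>\<^sub>v e" "0\<^sub>v n" "S + s" "S - s"] that
    unfolding step by (simp add: heis_def)
  then show ?thesis by blast
qed

text \<open>The point \<open>(x, y, t)\<close> lies on a horizontal segment from a point \<open>B\<close> of a fixed line transversal to the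
  plane \<open>t = 0\<close> to a point \<open>A\<close> of that plane; the sign conditions make the height of \<open>B\<close> at least \<open>2t\<close>,
  so that \<open>A\<close> stays in a bounded region.\<close>

lemma bounded_above_wedge:
  assumes "\<alpha> \<noteq> 0" "r \<ge> 0"
  shows "\<exists>M. \<forall>x y t. (x, y, t) \<in> hbox n r \<longrightarrow> \<bar>\<alpha> * y $ 0\<bar> \<le> 1 / 2 \<longrightarrow> t\<^sup>2 \<le> - (t * x $ 0 / \<alpha>) \<longrightarrow> \<phi> (x, y, t) \<le> M"
proof -
  \<comment> \<open>\<open>S\<close> will bound the parameter \<open>s\<close> of the point
    \<open>B\<close>, and \<open>r'\<close> the coordinates of the point \<open>A\<close>.\<close>
  define S where "S = r + 2 * r / \<bar>\<alpha>\<bar>"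
  have S: "S \<ge> 0" using assms by (simp add: S_def)
  define r' where "r' = 2 * r + \<bar>\<alpha>\<bar> * S + 1 / \<bar>\<alpha>\<bar>"
  obtain M1 where M1: "\<And>s. \<bar>s\<bar> \<le> S \<Longrightarrow> \<phi> ((\<alpha> * s) \<cdot>\<^sub>v e, (1 / \<alpha>) \<cdot>\<^sub>v e, 2 * s) \<le> M1"
    using bounded_above_line[OF assms(1) S] by blast
  obtain M2 where M2: "\<And>x y. (x, y, 0) \<in> hbox n r' \<Longrightarrow> \<phi> (x, y, 0) \<le> M2"
    using bounded_above_plane[of r'] by blast
  have "\<phi> (x, y, t) \<le> max M2 M1"
    if box: "(x, y, t) \<in> hbox n r" and y0: "\<bar>\<alpha> * y $ 0\<bar> \<le> 1 / 2" and t: "t\<^sup>2 \<le> - (t * x $ 0 / \<alpha>)" for x y t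
  proof -
    have rr': "r \<le> r'" using assms S by (simp add: r'_def)
    have c: "x \<in> carrier_vec n" "y \<in> carrier_vec n" using box by (auto simp: hbox_def heis_def)
    have x0: "\<bar>x $ 0\<bar> \<le> r" "\<bar>t\<bar> \<le> r" using box n_pos by (auto simp: hbox_def)
    show ?thesis
    proof (cases "t = 0")
      case True
      then show ?thesis using M2[of x y] hbox_mono[OF rr', of n] box by auto
    next
      case False
      define D where "D = 1 - \<alpha> * y $ 0"
      define X where "X = - (x $ 0 / \<alpha>)"
      \<comment> \<open>The parameter at which the fixed line meets the horizontal plane of
        \<open>(x, y, t)\<close>; this condition is the linear equation
        \<open>2 * s * D = t + 2 * X\<close>.\<close>
      define s where "s = (t + 2 * X) / (2 * D)"
      \<comment> \<open>Continuing the segment from \<open>B\<close> beyond \<open>(x, y, t)\<close>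
        by the fraction \<open>\<mu>\<close> of its length brings the height from \<open>t\<close>
        to 0.\<close>
      define \<mu> where "\<mu> = t / (2 * s - t)"
      have D: "1 / 2 \<le> D" "D \<le> 3 / 2" using y0 by (auto simp: D_def abs_le_iff)
      have tX: "t * t \<le> t * X" using t by (simp add: X_def power2_eq_square)
      have sD: "2 * s * D = t + 2 * X" using D by (simp add: s_def)
      have "\<bar>s\<bar> = \<bar>t + 2 * X\<bar> / (2 * D)" using D by (simp add: s_def)
      also have "\<dots> \<le> \<bar>t + 2 * X\<bar> / 1" using D by (intro divide_left_mono) auto
      also have "\<dots> \<le> \<bar>t\<bar> + 2 * (\<bar>x $ 0\<bar> / \<bar>\<alpha>\<bar>)" by (simp add: X_def flip: abs_divide)
      also have "\<dots> \<le> r + 2 * (r / \<bar>\<alpha>\<bar>)" using x0 by (intro add_mono mult_left_mono divide_right_mono) auto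
      finally have sS: "\<bar>s\<bar> \<le> S" by (simp add: S_def)
      have \<mu>: "0 \<le> \<mu>" "\<mu> \<le> 1" and \<mu>s: "\<mu> * (2 * s - t) = t"
      proof -
        \<comment> \<open>The wedge condition puts \<open>X\<close> beyond \<open>t\<close> on the
          same side of 0. For positive \<open>t\<close>, \<open>D \<le> 3 / 2\<close> gives
          \<open>2 * t * D \<le> 3 * t \<le> t + 2 * X\<close>; negative \<open>t\<close> is
          symmetric. Hence \<open>2 * s - t\<close> has the sign of \<open>t\<close> and at least
          its size, so \<open>\<mu>\<close> lies in the unit interval.\<close>
        have "(t > 0 \<and> s \<ge> t) \<or> (t < 0 \<and> s \<le> t)"
        proof (cases "t > 0")
          case True
          then have "t \<le> X" using tX by simp
          moreover have "t * D \<le> t * (3 / 2)" using True D by (intro mult_left_mono) auto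
          ultimately have "2 * t * D \<le> t + 2 * X" by simp
          then show ?thesis using True D by (simp add: s_def field_simps)
        next
          case False
          then have t: "t < 0" using \<open>t \<noteq> 0\<close> by simp
          then have "X \<le> t" using tX by (simp add: mult_le_cancel_left)
          moreover have "t * (3 / 2) \<le> t * D" using t D by (intro mult_left_mono_neg) auto
          ultimately have "t + 2 * X \<le> 2 * t * D" by simp
          then show ?thesis using t D by (simp add: s_def field_simps)
        qed
        then show "0 \<le> \<mu>" "\<mu> \<le> 1" "\<mu> * (2 * s - t) = t" by (auto simp: \<mu>_def divide_simps)
      qed
      define a where "a = (\<alpha> * s) \<cdot>\<^sub>v e - x"
      define b where "b = (1 / \<alpha>) \<cdot>\<^sub>v e - y"
      have ab: "a \<in> carrier_vec n" "b \<in> carrier_vec n" using c by (auto simp: a_def b_def)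
      have ay: "scalar_prod a y = \<alpha> * s * y $ 0 - scalar_prod x y"
        using c n_pos by (simp add: a_def minus_scalar_prod_distrib[where n=n])
      have xb: "scalar_prod x b = x $ 0 / \<alpha> - scalar_prod x y"
        using c n_pos by (simp add: b_def scalar_prod_minus_distrib[where n=n])
      have h: "2 * (scalar_prod a y - scalar_prod x b) = 2 * s - t"
      proof -
        have "2 * s + 2 * (x $ 0 / \<alpha>) = t + 2 * (\<alpha> * s * y $ 0)" using sD by (simp add: X_def D_def algebra_simps)
        then show ?thesis unfolding ay xb by argo
      qed
      have B: "(x, y, t) \<circ>\<^sub>H (1 \<cdot>\<^sub>v a, 1 \<cdot>\<^sub>v b, 0) = ((\<alpha> * s) \<cdot>\<^sub>v e, (1 / \<alpha>) \<cdot>\<^sub>v e, 2 * s)"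
        using h c by (auto simp: a_def b_def intro!: eq_vecI)
      have A: "(x, y, t) \<circ>\<^sub>H ((- \<mu>) \<cdot>\<^sub>v a, (- \<mu>) \<cdot>\<^sub>v b, 0) = (x + (- \<mu>) \<cdot>\<^sub>v a, y + (- \<mu>) \<cdot>\<^sub>v b, 0)"
      proof -
        have "t + 2 * (- \<mu> * scalar_prod a y - - \<mu> * scalar_prod x b) = t - \<mu> * (2 * (scalar_prod a y - scalar_prod x b))"
          by (simp add: algebra_simps)
        also have "\<dots> = 0" unfolding h using \<mu>s by simp
        finally show ?thesis using c ab by simp
      qed
      have "(x + (- \<mu>) \<cdot>\<^sub>v a, y + (- \<mu>) \<cdot>\<^sub>v b, 0) \<in> hbox n r'"
      proof -
        have "\<bar>x $ i + - \<mu> * a $ i\<bar> \<le> r' \<and> \<bar>y $ i + - \<mu> * b $ i\<bar> \<le> r'" if i: "i < n" for i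
        proof -
          have xi: "\<bar>x $ i\<bar> \<le> r" "\<bar>y $ i\<bar> \<le> r" using box i by (auto simp: hbox_def)
          have ei: "\<bar>e $ i\<bar> \<le> 1" using i by simp
          have "\<bar>\<alpha> * s * e $ i\<bar> \<le> \<bar>\<alpha>\<bar> * S * 1"
            unfolding abs_mult using ei sS S by (intro mult_mono) auto
          moreover have "a $ i = \<alpha> * s * e $ i - x $ i" using i c by (simp add: a_def)
          ultimately have ai: "\<bar>a $ i\<bar> \<le> \<bar>\<alpha>\<bar> * S + r"
            using xi by linarith
          have "\<bar>1 / \<alpha> * e $ i\<bar> \<le> \<bar>1 / \<alpha>\<bar> * 1"
            unfolding abs_mult using ei by (intro mult_left_mono) auto
          then have "\<bar>1 / \<alpha> * e $ i\<bar> \<le> 1 / \<bar>\<alpha>\<bar>" by simp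
          moreover have "b $ i = 1 / \<alpha> * e $ i - y $ i" using i c by (simp add: b_def)
          ultimately have bi: "\<bar>b $ i\<bar> \<le> 1 / \<bar>\<alpha>\<bar> + r"
            using xi by linarith
          have mu_abs: "\<bar>- \<mu> * z\<bar> \<le> \<bar>z\<bar>" for z
            using \<mu> mult_right_mono[of \<mu> 1 "\<bar>z\<bar>"] by (simp add: abs_mult)
          have "\<bar>- \<mu> * a $ i\<bar> \<le> \<bar>\<alpha>\<bar> * S + r" "\<bar>- \<mu> * b $ i\<bar> \<le> 1 / \<bar>\<alpha>\<bar> + r"
            by (rule order_trans[OF mu_abs ai], rule order_trans[OF mu_abs bi])
          moreover have "0 \<le> \<bar>\<alpha>\<bar> * S" "0 \<le> 1 / \<bar>\<alpha>\<bar>" using S by auto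
          ultimately show ?thesis using xi unfolding r'_def by linarith
        qed
        then show ?thesis using c ab rr' assms by (auto simp: hbox_def heis_def)
      qed
      from M2[OF this] have 2: "\<phi> ((x, y, t) \<circ>\<^sub>H ((- \<mu>) \<cdot>\<^sub>v a, (- \<mu>) \<cdot>\<^sub>v b, 0)) \<le> M2"
        unfolding A .
      have 1: "\<phi> ((x, y, t) \<circ>\<^sub>H (1 \<cdot>\<^sub>v a, 1 \<cdot>\<^sub>v b, 0)) \<le> M1"
        unfolding B using M1[OF sS] .
      show ?thesis
        using hconvex_le_max[OF convex hbox_heis[OF box] ab \<mu>(1), of 1] 1 2 by linarith
    qed
  qed
  then show ?thesis by blast
qed

text \<open>The zero vector keeps its scalar so that the displacement has the shape occurring in
  \<open>hconvex_le_max\<close> and \<open>hconvex_midpoint\<close>.\<close>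

lemma shift_e:
  assumes "x \<in> carrier_vec n" "y \<in> carrier_vec n"
  shows "(x, y, t) \<circ>\<^sub>H (l \<cdot>\<^sub>v e, l \<cdot>\<^sub>v 0\<^sub>v n, 0) = (x + l \<cdot>\<^sub>v e, y, t + 2 * l * y $ 0)"
    and "(x, y, t) \<circ>\<^sub>H (l \<cdot>\<^sub>v 0\<^sub>v n, l \<cdot>\<^sub>v e, 0) = (x, y + l \<cdot>\<^sub>v e, t - 2 * l * x $ 0)"
  using assms n_pos by (auto intro!: eq_vecI)

lemma e_hbox: "(l \<cdot>\<^sub>v e, l' \<cdot>\<^sub>v 0\<^sub>v n, 0) \<in> hbox n \<bar>l\<bar>" "(l' \<cdot>\<^sub>v 0\<^sub>v n, l \<cdot>\<^sub>v e, 0) \<in> hbox n \<bar>l\<bar>"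
  by (auto simp: hbox_def heis_def)

text \<open>The wedges for \<open>\<beta>\<close> and \<open>- \<beta>\<close> together cover the
  points whose first coordinate is large. A point of the box is the midpoint of two such points,
  reached by moving \<open>2 * r\<close> along \<open>e\<close> in both directions.\<close>

lemma bounded_above: "\<exists>M. \<forall>\<xi>\<in>hbox n r. \<phi> \<xi> \<le> M"
proof (cases "r > 0")
  case False
  obtain M where "\<And>x y. (x, y, 0) \<in> hbox n r \<Longrightarrow> \<phi> (x, y, 0) \<le> M" using bounded_above_plane by blast
  moreover have "t = 0" if "(x, y, t) \<in> hbox n r" for x y t
  proof -
    have "\<bar>t\<bar> \<le> r" using that by (simp add: hbox_def)
    then show ?thesis using False by linarith
  qed
  ultimately show ?thesis by fast
next
  case True
  \<comment> \<open>Small enough that \<open>\<beta> * r \<le> 1 / 2\<close>, and such that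
    \<open>r / \<beta> = r + 4 * (r * r)\<close> is the bound on the height after a shift by
    \<open>2 * r\<close>.\<close>
  define \<beta> where "\<beta> = 1 / (1 + 4 * r)"
  have \<beta>: "\<beta> > 0" "\<beta> * r \<le> 1 / 2" "r / \<beta> = r + 4 * (r * r)"
    using True by (auto simp: \<beta>_def field_simps)
  define r' where "r' = r + 2 * r + 4 * real n * (r * (2 * r))"
  have r': "r' \<ge> 0" using True by (simp add: r'_def)
  obtain M1 where M1: "\<And>x y t. (x, y, t) \<in> hbox n r' \<Longrightarrow> \<bar>\<beta> * y $ 0\<bar> \<le> 1 / 2 \<Longrightarrow> t\<^sup>2 \<le> - (t * x $ 0 / \<beta>) \<Longrightarrow> \<phi> (x, y, t) \<le> M1"
    using bounded_above_wedge[of \<beta> r'] \<beta> r' by (metis less_irrefl)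
  obtain M2 where M2: "\<And>x y t. (x, y, t) \<in> hbox n r' \<Longrightarrow> \<bar>- \<beta> * y $ 0\<bar> \<le> 1 / 2 \<Longrightarrow> t\<^sup>2 \<le> - (t * x $ 0 / (- \<beta>)) \<Longrightarrow> \<phi> (x, y, t) \<le> M2"
    using bounded_above_wedge[of "- \<beta>" r'] \<beta> r' by (metis less_irrefl neg_equal_0_iff_equal)
  have far: "\<phi> (x, y, t) \<le> max M1 M2"
    if "(x, y, t) \<in> hbox n r'" and y: "\<bar>y $ 0\<bar> \<le> r" and x: "r \<le> \<bar>x $ 0\<bar>" and t: "\<bar>t\<bar> \<le> r + 4 * (r * r)" for x y t
  proof -
    have "\<beta> * \<bar>y $ 0\<bar> \<le> \<beta> * r" using y \<beta> by (intro mult_left_mono) auto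
    then have "\<bar>\<beta> * y $ 0\<bar> \<le> 1 / 2" using \<beta>(1,2) unfolding abs_mult by linarith
    then have y': "\<bar>\<beta> * y $ 0\<bar> \<le> 1 / 2" "\<bar>- \<beta> * y $ 0\<bar> \<le> 1 / 2" by (simp_all add: abs_mult)
    have "r / \<beta> \<le> \<bar>x $ 0\<bar> / \<beta>" using x \<beta> by (intro divide_right_mono) auto
    then have "\<bar>t\<bar> \<le> \<bar>x $ 0\<bar> / \<beta>" using t \<beta> by simp
    then have "\<bar>t\<bar> * \<bar>t\<bar> \<le> \<bar>t\<bar> * (\<bar>x $ 0\<bar> / \<beta>)" by (intro mult_left_mono) auto
    then have "t\<^sup>2 \<le> \<bar>t * x $ 0\<bar> / \<beta>" by (simp add: power2_eq_square abs_mult)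
    \<comment> \<open>The sign of \<open>t * x $ 0\<close> decides which of the two wedges contains
      the point.\<close>
    then have "t\<^sup>2 \<le> - (t * x $ 0 / \<beta>) \<or> t\<^sup>2 \<le> - (t * x $ 0 / (- \<beta>))"
      by (cases "t * x $ 0 \<ge> 0") auto
    then show ?thesis using M1[OF that(1) y'(1)] M2[OF that(1) y'(2)] by linarith
  qed
  have "\<phi> (x, y, t) \<le> max M1 M2" if box: "(x, y, t) \<in> hbox n r" for x y t
  proof -
    have c: "x \<in> carrier_vec n" "y \<in> carrier_vec n" using box by (auto simp: hbox_def heis_def)
    have x0: "\<bar>x $ 0\<bar> \<le> r" "\<bar>y $ 0\<bar> \<le> r" "\<bar>t\<bar> \<le> r" using box n_pos by (auto simp: hbox_def)
    have "\<phi> ((x, y, t) \<circ>\<^sub>H (l \<cdot>\<^sub>v e, l \<cdot>\<^sub>v 0\<^sub>v n, 0)) \<le> max M1 M2" if l: "\<bar>l\<bar> = 2 * r" for l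
    proof -
      have "(x, y, t) \<circ>\<^sub>H (l \<cdot>\<^sub>v e, l \<cdot>\<^sub>v 0\<^sub>v n, 0) \<in> hbox n r'"
        using hmult_hbox[OF box e_hbox(1)[of l l]] l by (simp add: r'_def)
      moreover have "r \<le> \<bar>x $ 0 + l\<bar>" using l x0 by linarith
      moreover have "\<bar>l * y $ 0\<bar> \<le> 2 * r * r" unfolding abs_mult l using x0 True by (intro mult_mono) auto
      then have "\<bar>t + 2 * l * y $ 0\<bar> \<le> r + 4 * (r * r)" using x0 by linarith
      ultimately show ?thesis unfolding shift_e[OF c] using x0 c n_pos by (intro far) auto
    qed
    from this[of "- (2 * r)"] this[of "2 * r"]
    have "\<phi> ((x, y, t) \<circ>\<^sub>H ((- (2 * r)) \<cdot>\<^sub>v e, (- (2 * r)) \<cdot>\<^sub>v 0\<^sub>v n, 0)) \<le> max M1 M2"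
      "\<phi> ((x, y, t) \<circ>\<^sub>H ((2 * r) \<cdot>\<^sub>v e, (2 * r) \<cdot>\<^sub>v 0\<^sub>v n, 0)) \<le> max M1 M2"
      using True by linarith+
    moreover have "e \<in> carrier_vec n" "0\<^sub>v n \<in> carrier_vec n" "0 \<le> 2 * r" using True by auto
    ultimately show ?thesis
      using hconvex_le_max[OF convex hbox_heis[OF box], of e "0\<^sub>v n" "2 * r" "2 * r"]
      by (meson max.boundedI order_trans)
  qed
  then show ?thesis by fast
qed

lemma hconvex_midpoint:
  assumes \<xi>: "\<xi> \<in> heis n" and ab: "a \<in> carrier_vec n" "b \<in> carrier_vec n"
  shows "2 * \<phi> (\<xi> \<circ>\<^sub>H (l \<cdot>\<^sub>v a, l \<cdot>\<^sub>v b, 0)) \<le> \<phi> \<xi> + \<phi> (\<xi> \<circ>\<^sub>H ((2 * l) \<cdot>\<^sub>v a, (2 * l) \<cdot>\<^sub>v b, 0))"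
proof -
  from hconvex_line[OF convex \<xi>, of "(2 * l) \<cdot>\<^sub>v a" "(2 * l) \<cdot>\<^sub>v b" "1/2"] ab
  show ?thesis by (simp add: smult_smult_assoc del: hmult.simps)
qed

text \<open>If the midpoint of a horizontal segment has a value bounded below and one end a value
  bounded above, the other end is bounded below. This is applied twice: first with a midpoint at
  height 0, where \<open>\<phi>\<close> is nonnegative, then with a midpoint whose first coordinate
  is at least 1.\<close>

lemma bounded_below: "\<exists>M. \<forall>\<xi>\<in>hbox n r. M \<le> \<phi> \<xi>"
proof -
  have far: "\<exists>M. \<forall>x y t. (x, y, t) \<in> hbox n r \<longrightarrow> 1 \<le> x $ 0 \<longrightarrow> M \<le> \<phi> (x, y, t)" for r
  proof -
    let ?r = "r + r + 4 * real n * (r * r)"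
    obtain M where M: "\<And>\<xi>. \<xi> \<in> hbox n ?r \<Longrightarrow> \<phi> \<xi> \<le> M" using bounded_above by blast
    have "- M \<le> \<phi> (x, y, t)" if box: "(x, y, t) \<in> hbox n r" and x: "1 \<le> x $ 0" for x y t
    proof -
      \<comment> \<open>A step \<open>l\<close> in the y-direction lowers the height by
        \<open>2 * l * x $ 0\<close>, hence to 0; \<open>1 \<le> x $ 0\<close> keeps the step
        bounded.\<close>
      define l where "l = t / (2 * x $ 0)"
      have c: "x \<in> carrier_vec n" "y \<in> carrier_vec n" using box by (auto simp: hbox_def heis_def)
      have "\<bar>2 * l\<bar> = \<bar>t\<bar> / x $ 0" using x by (simp add: l_def)
      also have "\<dots> \<le> \<bar>t\<bar> / 1" using x by (intro divide_left_mono) auto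
      also have "\<dots> \<le> r" using box by (simp add: hbox_def)
      finally have "((2 * l) \<cdot>\<^sub>v 0\<^sub>v n, (2 * l) \<cdot>\<^sub>v e, 0) \<in> hbox n r" using e_hbox(2)[of "2 * l" "2 * l"] hbox_mono by blast
      then have "(x, y, t) \<circ>\<^sub>H ((2 * l) \<cdot>\<^sub>v 0\<^sub>v n, (2 * l) \<cdot>\<^sub>v e, 0) \<in> hbox n ?r"
        by (rule hmult_hbox[OF box])
      then have "\<phi> ((x, y, t) \<circ>\<^sub>H ((2 * l) \<cdot>\<^sub>v 0\<^sub>v n, (2 * l) \<cdot>\<^sub>v e, 0)) \<le> M" by (rule M)
      moreover have "t - 2 * l * x $ 0 = 0" using x by (simp add: l_def)
      then have "0 \<le> \<phi> ((x, y, t) \<circ>\<^sub>H (l \<cdot>\<^sub>v 0\<^sub>v n, l \<cdot>\<^sub>v e, 0))"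
        unfolding shift_e[OF c] using c by (simp add: phi_nonneg)
      ultimately show ?thesis
        using hconvex_midpoint[OF hbox_heis[OF box], of "0\<^sub>v n" e l] by (simp del: hmult.simps)
    qed
    then show ?thesis by blast
  qed
  \<comment> \<open>Shifting by \<open>?l\<close> lifts the first coordinate of any point of the box
    to at least 1.\<close>
  let ?l = "\<bar>r\<bar> + 1"
  let ?r = "r + 2 * ?l + 4 * real n * (r * (2 * ?l))"
  obtain M where M: "\<And>\<xi>. \<xi> \<in> hbox n ?r \<Longrightarrow> \<phi> \<xi> \<le> M" using bounded_above by blast
  obtain M' where M': "\<And>x y t. (x, y, t) \<in> hbox n ?r \<Longrightarrow> 1 \<le> x $ 0 \<Longrightarrow> M' \<le> \<phi> (x, y, t)" using far[of ?r] by blast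
  have "2 * M' - M \<le> \<phi> (x, y, t)" if box: "(x, y, t) \<in> hbox n r" for x y t
  proof -
    have c: "x \<in> carrier_vec n" "y \<in> carrier_vec n" using box by (auto simp: hbox_def heis_def)
    have x0: "\<bar>x $ 0\<bar> \<le> r" using box n_pos by (auto simp: hbox_def)
    have in_box: "(x, y, t) \<circ>\<^sub>H (l \<cdot>\<^sub>v e, l \<cdot>\<^sub>v 0\<^sub>v n, 0) \<in> hbox n ?r" if "\<bar>l\<bar> \<le> 2 * ?l" for l
      using hmult_hbox[OF box, of _ "2 * ?l"] e_hbox(1)[of l l] hbox_mono[OF that] by blast
    have "\<phi> ((x, y, t) \<circ>\<^sub>H ((2 * ?l) \<cdot>\<^sub>v e, (2 * ?l) \<cdot>\<^sub>v 0\<^sub>v n, 0)) \<le> M"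
      by (intro M in_box) simp
    moreover have "M' \<le> \<phi> ((x, y, t) \<circ>\<^sub>H (?l \<cdot>\<^sub>v e, ?l \<cdot>\<^sub>v 0\<^sub>v n, 0))"
    proof -
      have "(x + ?l \<cdot>\<^sub>v e, y, t + 2 * ?l * y $ 0) \<in> hbox n ?r" using in_box[of ?l] unfolding shift_e[OF c] by simp
      then show ?thesis unfolding shift_e[OF c] by (rule M') (use x0 c n_pos in auto)
    qed
    ultimately show ?thesis
      using hconvex_midpoint[OF hbox_heis[OF box], of e "0\<^sub>v n" ?l] by (simp del: hmult.simps)
  qed
  then show ?thesis by fast
qed

lemma bounded_box: "\<exists>M. \<forall>\<xi>\<in>hbox n r. \<bar>\<phi> \<xi>\<bar> \<le> M"
proof -
  obtain M M' where "\<forall>\<xi>\<in>hbox n r. \<phi> \<xi> \<le> M" "\<forall>\<xi>\<in>hbox n r. M' \<le> \<phi> \<xi>"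
    using bounded_above bounded_below by metis
  then show ?thesis by (intro exI[of _ "max M (- M')"]) (auto simp: abs_le_iff max_def)
qed

end

section \<open>Continuity\<close>

definition hconv :: "nat \<Rightarrow> (nat \<Rightarrow> heis_pt) \<Rightarrow> heis_pt \<Rightarrow> bool" where
  "hconv n X \<xi> \<longleftrightarrow>
     (\<forall>i<n. (\<lambda>k. fst (X k) $ i) \<longlonglongrightarrow> fst \<xi> $ i \<and> (\<lambda>k. fst (snd (X k)) $ i) \<longlonglongrightarrow> fst (snd \<xi>) $ i) \<and>
     (\<lambda>k. snd (snd (X k))) \<longlonglongrightarrow> snd (snd \<xi>)"

lemma hconv_const: "hconv n (\<lambda>_. \<xi>) \<xi>"
  by (simp add: hconv_def)

lemma scalar_prod_self_nonneg: "0 \<le> scalar_prod x (x :: real vec)"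
  by (simp add: scalar_prod_def sum_nonneg)

lemma sq_index_le_scalar_prod:
  fixes x :: "real vec"
  assumes "x \<in> carrier_vec n" "i < n"
  shows "(x $ i)\<^sup>2 \<le> scalar_prod x x"
proof -
  have "x $ i * x $ i \<le> (\<Sum>j<n. x $ j * x $ j)"
    using assms by (intro member_le_sum[of i "{..<n}" "\<lambda>j. x $ j * x $ j"]) auto
  then show ?thesis using assms by (simp add: scalar_prod_def lessThan_atLeast0 power2_eq_square)
qed

lemma tendsto_scalar_prod:
  fixes x y :: "nat \<Rightarrow> real vec"
  assumes "\<And>k. y k \<in> carrier_vec n" "b \<in> carrier_vec n"
    "\<And>i. i < n \<Longrightarrow> (\<lambda>k. x k $ i) \<longlonglongrightarrow> a $ i" "\<And>i. i < n \<Longrightarrow> (\<lambda>k. y k $ i) \<longlonglongrightarrow> b $ i"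
  shows "(\<lambda>k. scalar_prod (x k) (y k)) \<longlonglongrightarrow> scalar_prod a b"
proof -
  have d: "dim_vec (y k) = n" "dim_vec b = n" for k using assms(1)[of k] assms(2) by auto
  show ?thesis unfolding scalar_prod_def d using assms(3,4) by (intro tendsto_sum tendsto_mult) auto
qed

lemma hconv_mult:
  assumes X: "\<And>k. X k \<in> heis n" "\<xi> \<in> heis n" "hconv n X \<xi>"
    and Y: "\<And>k. Y k \<in> heis n" "\<eta> \<in> heis n" "hconv n Y \<eta>"
  shows "hconv n (\<lambda>k. X k \<circ>\<^sub>H Y k) (\<xi> \<circ>\<^sub>H \<eta>)"
proof -
  have e: "\<zeta> \<circ>\<^sub>H \<omega> = (fst \<zeta> + fst \<omega>, fst (snd \<zeta>) + fst (snd \<omega>),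
     snd (snd \<zeta>) + snd (snd \<omega>) + 2 * (scalar_prod (fst \<omega>) (fst (snd \<zeta>)) - scalar_prod (fst \<zeta>) (fst (snd \<omega>))))" for \<zeta> \<omega>
    by (cases \<zeta>; cases \<omega>) simp
  have c: "fst \<zeta> \<in> carrier_vec n" "fst (snd \<zeta>) \<in> carrier_vec n" if "\<zeta> \<in> heis n" for \<zeta>
    using that by (auto simp: heis_def)
  note cs = c[OF X(1)] c[OF X(2)] c[OF Y(1)] c[OF Y(2)]
  have d: "dim_vec (fst (Y k)) = n" "dim_vec (fst (snd (Y k))) = n" "dim_vec (fst \<eta>) = n" "dim_vec (fst (snd \<eta>)) = n" for k
    using cs by auto
  have XY: "(\<lambda>k. fst (X k) $ i) \<longlonglongrightarrow> fst \<xi> $ i" "(\<lambda>k. fst (snd (X k)) $ i) \<longlonglongrightarrow> fst (snd \<xi>) $ i"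
    "(\<lambda>k. fst (Y k) $ i) \<longlonglongrightarrow> fst \<eta> $ i" "(\<lambda>k. fst (snd (Y k)) $ i) \<longlonglongrightarrow> fst (snd \<eta>) $ i"
    if "i < n" for i using X(3) Y(3) that by (auto simp: hconv_def)
  have "(\<lambda>k. scalar_prod (fst (Y k)) (fst (snd (X k)))) \<longlonglongrightarrow> scalar_prod (fst \<eta>) (fst (snd \<xi>))"
    "(\<lambda>k. scalar_prod (fst (X k)) (fst (snd (Y k)))) \<longlonglongrightarrow> scalar_prod (fst \<xi>) (fst (snd \<eta>))"
    by (auto intro!: tendsto_scalar_prod[where n=n] cs XY)
  then have "(\<lambda>k. snd (snd (X k \<circ>\<^sub>H Y k))) \<longlonglongrightarrow> snd (snd (\<xi> \<circ>\<^sub>H \<eta>))"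
    unfolding e using X(3) Y(3)
    by (auto simp: hconv_def intro!: tendsto_add tendsto_diff tendsto_mult)
  moreover have "(\<lambda>k. fst (X k \<circ>\<^sub>H Y k) $ i) \<longlonglongrightarrow> fst (\<xi> \<circ>\<^sub>H \<eta>) $ i"
    "(\<lambda>k. fst (snd (X k \<circ>\<^sub>H Y k)) $ i) \<longlonglongrightarrow> fst (snd (\<xi> \<circ>\<^sub>H \<eta>)) $ i" if "i < n" for i
    using XY[OF that] that by (simp_all add: e d tendsto_add)
  ultimately show ?thesis by (simp add: hconv_def)
qed

text \<open>The single real quantity \<open>q\<close> converges, hence is bounded, and it controls
  all coordinates through \<open>\<bar>x $ i\<bar> \<le> (x $ i)\<^sup>2 + 1\<close>.\<close>

lemma hconv_hbox:
  assumes X: "\<And>k. X k \<in> heis n" and \<xi>: "\<xi> \<in> heis n" and conv: "hconv n X \<xi>"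
  obtains r where "\<And>k. X k \<in> hbox n r"
proof -
  define q where "q \<zeta> = scalar_prod (fst \<zeta>) (fst \<zeta>) + scalar_prod (fst (snd \<zeta>)) (fst (snd \<zeta>)) + \<bar>snd (snd \<zeta>)\<bar>" for \<zeta> :: heis_pt
  have c: "fst \<zeta> \<in> carrier_vec n" "fst (snd \<zeta>) \<in> carrier_vec n" if "\<zeta> \<in> heis n" for \<zeta>
    using that by (auto simp: heis_def)
  have "(\<lambda>k. q (X k)) \<longlonglongrightarrow> q \<xi>"
    unfolding q_def using conv c[OF X] c[OF \<xi>] unfolding hconv_def
    by (intro tendsto_add tendsto_rabs tendsto_scalar_prod[where n=n]) auto
  then obtain B where B: "\<And>k. \<bar>q (X k)\<bar> \<le> B"
    by (metis BseqE convergentI convergent_imp_Bseq real_norm_def)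
  have sq: "\<bar>x $ i\<bar> \<le> scalar_prod x x + 1" if "x \<in> carrier_vec n" "i < n" for x :: "real vec" and i
  proof -
    have "0 \<le> (\<bar>x $ i\<bar> - 1)\<^sup>2" "0 \<le> (x $ i)\<^sup>2" by auto
    then have "\<bar>x $ i\<bar> \<le> (x $ i)\<^sup>2 + 1"
      by (simp add: power2_eq_square algebra_simps)
    then show ?thesis using sq_index_le_scalar_prod[OF that] by simp
  qed
  have "X k \<in> hbox n (B + 1)" for k
  proof -
    obtain x y t where e: "X k = (x, y, t)" by (cases "X k")
    have xy: "x \<in> carrier_vec n" "y \<in> carrier_vec n" using X[of k] by (auto simp: e heis_def)
    have "scalar_prod x x + scalar_prod y y + \<bar>t\<bar> \<le> B" using B[of k] by (simp add: e q_def)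
    then have "scalar_prod x x \<le> B" "scalar_prod y y \<le> B" "\<bar>t\<bar> \<le> B" using scalar_prod_self_nonneg[of x] scalar_prod_self_nonneg[of y] by linarith+
    then show ?thesis using sq[OF xy(1)] sq[OF xy(2)] X[of k] unfolding e hbox_def by force
  qed
  then show ?thesis by (rule that)
qed

lemma hbox_compact:
  fixes X :: "nat \<Rightarrow> heis_pt"
  assumes X: "\<And>k. X k \<in> hbox n r"
  obtains \<sigma> \<xi> where "strict_mono \<sigma>" "\<xi> \<in> heis n" "hconv n (\<lambda>k. X (\<sigma> k)) \<xi>"
proof -
  \<comment> \<open>The \<open>2 * n + 1\<close> coordinates as one function of an index: x first,
    then y, and the height at index \<open>2 * n\<close>. One subsequence can then be extracted for
    all of them.\<close>
  define f where "f k i = (if i < n then fst (X k) $ i else if i < 2 * n then fst (snd (X k)) $ (i - n) else snd (snd (X k)))" for k i :: nat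
  have bd: "\<bar>f k i\<bar> \<le> r" for k i
    using X[of k] by (cases "X k") (auto simp: f_def hbox_def)
  have "\<forall>\<delta>\<subseteq>{..2*n}. \<exists>l::nat\<Rightarrow>real. \<exists>\<sigma>::nat\<Rightarrow>nat. strict_mono \<sigma> \<and>
     (\<forall>\<epsilon>>0. eventually (\<lambda>k. \<forall>i\<in>\<delta>. dist (f (\<sigma> k) i) (l i) < \<epsilon>) sequentially)"
  proof (rule compact_lemma_general[where proj = "\<lambda>g. g" and unproj = "\<lambda>g. g"])
    show "bounded ((\<lambda>g. g k) ` range f)" for k
      using bd by (auto simp: bounded_iff)
  qed auto
  then obtain l :: "nat \<Rightarrow> real" and \<sigma> where \<sigma>: "strict_mono \<sigma>"
    and l: "\<And>\<epsilon>. \<epsilon> > 0 \<Longrightarrow> eventually (\<lambda>k. \<forall>i\<in>{..2*n}. dist (f (\<sigma> k) i) (l i) < \<epsilon>) sequentially"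
    by blast
  have lim: "(\<lambda>k. f (\<sigma> k) i) \<longlonglongrightarrow> l i" if "i \<le> 2 * n" for i
    unfolding tendsto_iff
  proof (intro allI impI)
    fix \<epsilon> :: real assume "\<epsilon> > 0"
    from l[OF this] show "eventually (\<lambda>k. dist (f (\<sigma> k) i) (l i) < \<epsilon>) sequentially"
      by (rule eventually_mono) (use that in auto)
  qed
  show ?thesis
  proof (rule that[OF \<sigma>])
    let ?\<xi> = "(vec n l, vec n (\<lambda>i. l (n + i)), l (2 * n)) :: heis_pt"
    show "?\<xi> \<in> heis n" by (simp add: heis_def)
    have "(\<lambda>k. fst (X (\<sigma> k)) $ i) \<longlonglongrightarrow> l i" "(\<lambda>k. fst (snd (X (\<sigma> k))) $ i) \<longlonglongrightarrow> l (n + i)" if "i < n" for i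
      using lim[of i] lim[of "n + i"] that by (auto simp: f_def)
    moreover have "(\<lambda>k. snd (snd (X (\<sigma> k)))) \<longlonglongrightarrow> l (2 * n)" using lim[of "2 * n"] by (auto simp: f_def)
    ultimately show "hconv n (\<lambda>k. X (\<sigma> k)) ?\<xi>" by (simp add: hconv_def)
  qed
qed

section \<open>Continuity of the function\<close>

context round_at_origin
begin

text \<open>Slopes of chords increase: when the \<open>N\<close>-fold displacement still stays in a
  bounded box, the increment over the short one is at most a fraction \<open>1 / N\<close> of the
  oscillation there.\<close>

lemma horizontal_difference_le:
  assumes \<xi>: "\<xi> \<in> hbox n r" and ab: "(N \<cdot>\<^sub>v a, N \<cdot>\<^sub>v b, 0) \<in> hbox n 1" and N: "1 \<le> N"
    and M: "\<And>\<zeta>. \<zeta> \<in> hbox n (r + 1 + 4 * real n * (r * 1)) \<Longrightarrow> \<bar>\<phi> \<zeta>\<bar> \<le> M"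
  shows "\<phi> (\<xi> \<circ>\<^sub>H (a, b, 0)) - \<phi> \<xi> \<le> 2 * M / N"
proof -
  have abc: "a \<in> carrier_vec n" "b \<in> carrier_vec n"
    using ab by (auto simp: hbox_def heis_def)
  have "(1 / N) \<cdot>\<^sub>v (N \<cdot>\<^sub>v v) = v" for v :: "real vec" using N by (simp add: smult_smult_assoc)
  then have "\<phi> (\<xi> \<circ>\<^sub>H (a, b, 0)) \<le> (1 - 1 / N) * \<phi> \<xi> + (1 / N) * \<phi> (\<xi> \<circ>\<^sub>H (N \<cdot>\<^sub>v a, N \<cdot>\<^sub>v b, 0))"
    using hconvex_line[OF convex hbox_heis[OF \<xi>], of "N \<cdot>\<^sub>v a" "N \<cdot>\<^sub>v b" "1 / N"] abc N by (simp del: hmult.simps)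
  then have 1: "\<phi> (\<xi> \<circ>\<^sub>H (a, b, 0)) - \<phi> \<xi> \<le> (\<phi> (\<xi> \<circ>\<^sub>H (N \<cdot>\<^sub>v a, N \<cdot>\<^sub>v b, 0)) - \<phi> \<xi>) / N"
    by (simp add: diff_divide_distrib algebra_simps)
  have r: "0 \<le> r" using \<xi> by (auto simp: hbox_def)
  then have "r \<le> r + 1 + 4 * real n * (r * 1)" by simp
  from subsetD[OF hbox_mono[OF this] \<xi>] have "\<bar>\<phi> \<xi>\<bar> \<le> M" by (rule M)
  moreover have "\<bar>\<phi> (\<xi> \<circ>\<^sub>H (N \<cdot>\<^sub>v a, N \<cdot>\<^sub>v b, 0))\<bar> \<le> M" by (intro M hmult_hbox \<xi> ab)
  ultimately have "\<phi> (\<xi> \<circ>\<^sub>H (N \<cdot>\<^sub>v a, N \<cdot>\<^sub>v b, 0)) - \<phi> \<xi> \<le> 2 * M" by linarith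
  then have "(\<phi> (\<xi> \<circ>\<^sub>H (N \<cdot>\<^sub>v a, N \<cdot>\<^sub>v b, 0)) - \<phi> \<xi>) / N \<le> 2 * M / N" using N by (intro divide_right_mono) auto
  with 1 show ?thesis by simp
qed

text \<open>A vanishing horizontal displacement changes \<open>\<phi>\<close> by a vanishing amount.
  The upper estimate steps forward from \<open>X k\<close>, the lower one steps back from the
  displaced point.\<close>

lemma horizontal_step:
  assumes X: "\<And>k. X k \<in> heis n" and \<xi>: "\<xi> \<in> heis n" and conv: "hconv n X \<xi>"
    and lim: "(\<lambda>k. \<phi> (X k)) \<longlonglongrightarrow> \<phi> \<xi>"
    and ab: "\<And>k. a k \<in> carrier_vec n" "\<And>k. b k \<in> carrier_vec n"
    and a0: "\<And>i. i < n \<Longrightarrow> (\<lambda>k. a k $ i) \<longlonglongrightarrow> 0" and b0: "\<And>i. i < n \<Longrightarrow> (\<lambda>k. b k $ i) \<longlonglongrightarrow> 0"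
  shows "hconv n (\<lambda>k. X k \<circ>\<^sub>H (a k, b k, 0)) \<xi>" "(\<lambda>k. \<phi> (X k \<circ>\<^sub>H (a k, b k, 0))) \<longlonglongrightarrow> \<phi> \<xi>"
proof -
  have h: "(a k, b k, 0) \<in> heis n" for k using ab by (simp add: heis_def)
  have o: "(0\<^sub>v n, 0\<^sub>v n, 0) \<in> heis n" by (simp add: heis_def)
  have ho: "hconv n (\<lambda>k. (a k, b k, 0)) (0\<^sub>v n, 0\<^sub>v n, 0)" using a0 b0 by (simp add: hconv_def)
  have "\<xi> \<circ>\<^sub>H (0\<^sub>v n, 0\<^sub>v n, 0) = \<xi>" using \<xi> by (cases \<xi>) (auto simp: heis_def)
  with hconv_mult[OF X \<xi> conv h o ho] show Y: "hconv n (\<lambda>k. X k \<circ>\<^sub>H (a k, b k, 0)) \<xi>" by simp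
  obtain r where r: "\<And>k. X k \<in> hbox n r" by (rule hconv_hbox[OF X \<xi> conv]) blast
  obtain r' where r': "\<And>k. X k \<circ>\<^sub>H (a k, b k, 0) \<in> hbox n r'"
    by (rule hconv_hbox[OF hmult_closed[OF X h] \<xi> Y]) blast
  obtain M where M: "\<And>\<zeta>. \<zeta> \<in> hbox n (r + 1 + 4 * real n * (r * 1)) \<Longrightarrow> \<bar>\<phi> \<zeta>\<bar> \<le> M" using bounded_box by blast
  obtain M' where M': "\<And>\<zeta>. \<zeta> \<in> hbox n (r' + 1 + 4 * real n * (r' * 1)) \<Longrightarrow> \<bar>\<phi> \<zeta>\<bar> \<le> M'" using bounded_box by blast
  have "(\<lambda>k. \<phi> (X k \<circ>\<^sub>H (a k, b k, 0)) - \<phi> (X k)) \<longlonglongrightarrow> 0"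
  proof (rule LIMSEQ_I)
    fix \<epsilon> :: real assume \<epsilon>: "\<epsilon> > 0"
    \<comment> \<open>Makes both \<open>2 * M / N\<close> and \<open>2 * M' / N\<close> smaller than
      \<open>\<epsilon>\<close>.\<close>
    define N where "N = 1 + (2 * \<bar>M\<bar> + 2 * \<bar>M'\<bar>) / \<epsilon>"
    have N: "1 \<le> N" using \<epsilon> by (simp add: N_def)
    have "2 * \<bar>M\<bar> + 2 * \<bar>M'\<bar> < N * \<epsilon>" using \<epsilon> by (simp add: N_def field_simps)
    then have small: "2 * M / N < \<epsilon>" "2 * M' / N < \<epsilon>" using N by (auto simp: divide_less_eq mult.commute)
    have "eventually (\<lambda>k. \<bar>a k $ i\<bar> < 1 / N \<and> \<bar>b k $ i\<bar> < 1 / N) sequentially" if "i < n" for i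
      using order_tendstoD(2)[OF tendsto_rabs_zero[OF a0[OF that]], of "1 / N"]
        order_tendstoD(2)[OF tendsto_rabs_zero[OF b0[OF that]], of "1 / N"] N
      by (auto intro: eventually_conj)
    then have "eventually (\<lambda>k. \<forall>i\<in>{..<n}. \<bar>a k $ i\<bar> < 1 / N \<and> \<bar>b k $ i\<bar> < 1 / N) sequentially"
      by (intro eventually_ball_finite) auto
    then obtain k0 where k0: "\<And>k i. k \<ge> k0 \<Longrightarrow> i < n \<Longrightarrow> \<bar>a k $ i\<bar> < 1 / N \<and> \<bar>b k $ i\<bar> < 1 / N"
      unfolding eventually_sequentially by fastforce
    have "norm (\<phi> (X k \<circ>\<^sub>H (a k, b k, 0)) - \<phi> (X k) - 0) < \<epsilon>" if "k \<ge> k0" for k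
    proof -
      have "\<bar>N * a k $ i\<bar> \<le> 1 \<and> \<bar>N * b k $ i\<bar> \<le> 1" if "i < n" for i
        using k0[OF \<open>k \<ge> k0\<close> that] N by (auto simp: abs_mult field_simps)
      then have "(N \<cdot>\<^sub>v a k, N \<cdot>\<^sub>v b k, 0) \<in> hbox n 1" "(N \<cdot>\<^sub>v (- a k), N \<cdot>\<^sub>v (- b k), 0) \<in> hbox n 1"
        using ab[of k] by (auto simp: hbox_def heis_def)
      from horizontal_difference_le[OF r this(1) N M] horizontal_difference_le[OF r' this(2) N M']
      have "\<phi> (X k \<circ>\<^sub>H (a k, b k, 0)) - \<phi> (X k) \<le> 2 * M / N"
        "\<phi> (X k \<circ>\<^sub>H (a k, b k, 0) \<circ>\<^sub>H (- a k, - b k, 0)) - \<phi> (X k \<circ>\<^sub>H (a k, b k, 0)) \<le> 2 * M' / N"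
        by auto
      moreover have "X k \<circ>\<^sub>H (a k, b k, 0) \<circ>\<^sub>H (- a k, - b k, 0) = X k"
      proof -
        have hk: "(- a k, - b k, 0) \<in> heis n" using ab by (simp add: heis_def)
        have "(a k, b k, 0) \<circ>\<^sub>H (- a k, - b k, 0) = (0\<^sub>v n, 0\<^sub>v n, 0)"
          using ab[of k] by (auto intro!: eq_vecI)
        then show ?thesis
          unfolding hmult_assoc[OF X h hk] using X[of k] by (cases "X k") (auto simp: heis_def)
      qed
      ultimately show ?thesis using small by (auto simp: abs_less_iff)
    qed
    then show "\<exists>no. \<forall>k\<ge>no. norm (\<phi> (X k \<circ>\<^sub>H (a k, b k, 0)) - \<phi> (X k) - 0) < \<epsilon>" by blast
  qed
  from tendsto_add[OF this lim] show "(\<lambda>k. \<phi> (X k \<circ>\<^sub>H (a k, b k, 0))) \<longlonglongrightarrow> \<phi> \<xi>" by simp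
qed

text \<open>A vertical displacement by \<open>\<tau>\<close> is a commutator of horizontal displacements of sizes
  \<open>s\<close> and \<open>s'\<close> with \<open>- 4 s s' = \<tau>\<close>; the cube root makes both factors continuous in \<open>\<tau>\<close>.\<close>

lemma phi_continuous:
  assumes X: "\<And>k. X k \<in> heis n" and \<xi>: "\<xi> \<in> heis n" and conv: "hconv n X \<xi>"
  shows "(\<lambda>k. \<phi> (X k)) \<longlonglongrightarrow> \<phi> \<xi>"
proof -
  define Y where "Y k = hinv \<xi> \<circ>\<^sub>H X k" for k
  define a where "a k = fst (Y k)" for k
  define b where "b k = fst (snd (Y k))" for k
  define \<tau> where "\<tau> k = snd (snd (Y k))" for k
  have Y: "Y k \<in> heis n" for k unfolding Y_def by (intro hmult_closed hinv_closed X \<xi>)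
  have Yeq: "Y k = (a k, b k, \<tau> k)" for k by (simp add: a_def b_def \<tau>_def)
  have ab: "a k \<in> carrier_vec n" "b k \<in> carrier_vec n" for k using Y[of k] by (auto simp: Yeq heis_def)
  have "hconv n Y (hinv \<xi> \<circ>\<^sub>H \<xi>)"
    unfolding Y_def by (intro hconv_mult hconv_const hinv_closed X \<xi> conv)
  then have "hconv n Y (0\<^sub>v n, 0\<^sub>v n, 0)" using \<xi> by (simp add: hinv_left)
  then have a0: "\<And>i. i < n \<Longrightarrow> (\<lambda>k. a k $ i) \<longlonglongrightarrow> 0" and b0: "\<And>i. i < n \<Longrightarrow> (\<lambda>k. b k $ i) \<longlonglongrightarrow> 0"
    and \<tau>0: "\<tau> \<longlonglongrightarrow> 0" by (auto simp: hconv_def a_def b_def \<tau>_def[abs_def])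
  define s where "s k = (root 3 (\<tau> k))\<^sup>2" for k
  define s' where "s' k = - root 3 (\<tau> k) / 4" for k
  have "(\<lambda>k. root 3 (\<tau> k)) \<longlonglongrightarrow> root 3 0" using \<tau>0 by (intro tendsto_real_root)
  then have r0: "(\<lambda>k. root 3 (\<tau> k)) \<longlonglongrightarrow> 0" by simp
  have s0: "s \<longlonglongrightarrow> 0" "s' \<longlonglongrightarrow> 0"
    unfolding s_def s'_def using tendsto_power[OF r0, of 2] tendsto_divide[OF tendsto_minus[OF r0] tendsto_const[of 4]] by auto
  have ss': "- 4 * (s k * s' k) = \<tau> k" for k
    using odd_real_root_pow[of 3 "\<tau> k"] by (simp add: s_def s'_def power2_eq_square power3_eq_cube)
  let ?s = "\<lambda>k. (s k \<cdot>\<^sub>v e, 0\<^sub>v n, 0) :: heis_pt" and ?s' = "\<lambda>k. (0\<^sub>v n, s' k \<cdot>\<^sub>v e, 0) :: heis_pt"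
  let ?t = "\<lambda>k. (- s k \<cdot>\<^sub>v e, 0\<^sub>v n, 0) :: heis_pt" and ?t' = "\<lambda>k. (0\<^sub>v n, - s' k \<cdot>\<^sub>v e, 0) :: heis_pt"
  have e0: "(\<lambda>k. (u k \<cdot>\<^sub>v e) $ i) \<longlonglongrightarrow> 0" if "u \<longlonglongrightarrow> 0" "i < n" for u i
    using that tendsto_mult_left_zero[OF that(1), of "e $ i"] by simp
  have z0: "(\<lambda>k. 0\<^sub>v n $ i) \<longlonglongrightarrow> (0::real)" if "i < n" for i using that by simp
  have ec: "u \<cdot>\<^sub>v e \<in> carrier_vec n" for u by simp
  have heis1: "\<zeta> \<in> heis n \<Longrightarrow> \<zeta> \<circ>\<^sub>H (u \<cdot>\<^sub>v e, 0\<^sub>v n, 0) \<in> heis n" "\<zeta> \<in> heis n \<Longrightarrow> \<zeta> \<circ>\<^sub>H (0\<^sub>v n, u \<cdot>\<^sub>v e, 0) \<in> heis n" for \<zeta> u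
    by (auto intro!: hmult_closed simp: heis_def)
  have t0: "(\<lambda>k. - s k) \<longlonglongrightarrow> 0" "(\<lambda>k. - s' k) \<longlonglongrightarrow> 0" using tendsto_minus[OF s0(1)] tendsto_minus[OF s0(2)] by auto
  \<comment> \<open>Starting from the constant sequence \<open>\<xi>\<close>, five horizontal steps
    are appended: four for the commutator, and the last one for the horizontal part
    \<open>(a k, b k)\<close>. Each keeps both the convergence of the points and that of the
    values.\<close>
  note 0 = hconv_const[of n \<xi>] tendsto_const[of "\<phi> \<xi>"]
  note 1 = horizontal_step[OF \<xi> \<xi> 0 ec zero_carrier_vec e0[OF s0(1)] z0]
  note 2 = horizontal_step[OF heis1(1)[OF \<xi>] \<xi> 1 zero_carrier_vec ec z0 e0[OF s0(2)]]
  note 3 = horizontal_step[OF heis1(2)[OF heis1(1)[OF \<xi>]] \<xi> 2 ec zero_carrier_vec e0[OF t0(1)] z0]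
  note 4 = horizontal_step[OF heis1(1)[OF heis1(2)[OF heis1(1)[OF \<xi>]]] \<xi> 3 zero_carrier_vec ec z0 e0[OF t0(2)]]
  note 5 = horizontal_step[OF heis1(2)[OF heis1(1)[OF heis1(2)[OF heis1(1)[OF \<xi>]]]] \<xi> 4 ab a0 b0]
  have "\<xi> \<circ>\<^sub>H ?s k \<circ>\<^sub>H ?s' k \<circ>\<^sub>H ?t k \<circ>\<^sub>H ?t' k \<circ>\<^sub>H (a k, b k, 0) = X k" for k
  proof -
    have "\<xi> \<circ>\<^sub>H ?s k \<circ>\<^sub>H ?s' k \<circ>\<^sub>H ?t k \<circ>\<^sub>H ?t' k \<circ>\<^sub>H (a k, b k, 0)
        = \<xi> \<circ>\<^sub>H (?s k \<circ>\<^sub>H ?s' k \<circ>\<^sub>H ?t k \<circ>\<^sub>H ?t' k \<circ>\<^sub>H (a k, b k, 0))"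
    proof -
      have "?s k \<in> heis n" "?s' k \<in> heis n" "?t k \<in> heis n" "?t' k \<in> heis n" "(a k, b k, 0) \<in> heis n"
        using ab[of k] by (auto simp: heis_def)
      then show ?thesis using \<xi> by (simp add: hmult_assoc[of _ n] hmult_closed del: hmult.simps)
    qed
    also have "?s k \<circ>\<^sub>H ?s' k \<circ>\<^sub>H ?t k \<circ>\<^sub>H ?t' k \<circ>\<^sub>H (a k, b k, 0) = Y k"
    proof -
      have comm: "?s k \<circ>\<^sub>H ?s' k \<circ>\<^sub>H ?t k \<circ>\<^sub>H ?t' k = (0\<^sub>v n, 0\<^sub>v n, - 4 * (s k * s' k))"
        using n_pos by (auto intro!: eq_vecI simp: algebra_simps)
      show ?thesis unfolding comm ss' Yeq using ab[of k] by simp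
    qed
    also have "\<xi> \<circ>\<^sub>H Y k = X k" unfolding Y_def by (rule hmult_inv_cancel[OF \<xi> X])
    finally show ?thesis .
  qed
  with 5(2) show ?thesis by simp
qed

end

section \<open>Density of points with a subgradient\<close>

lemma scalar_prod_add_smult_self:
  fixes u a :: "real vec"
  assumes "u \<in> carrier_vec n" "a \<in> carrier_vec n"
  shows "scalar_prod (u + l \<cdot>\<^sub>v a) (u + l \<cdot>\<^sub>v a) = scalar_prod u u + 2 * l * scalar_prod u a + l\<^sup>2 * scalar_prod a a"
proof -
  have "scalar_prod (u + l \<cdot>\<^sub>v a) (u + l \<cdot>\<^sub>v a)
      = scalar_prod u (u + l \<cdot>\<^sub>v a) + scalar_prod (l \<cdot>\<^sub>v a) (u + l \<cdot>\<^sub>v a)"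
    using assms by (intro add_scalar_prod_distrib[where n=n]) auto
  also have "scalar_prod u (u + l \<cdot>\<^sub>v a) = scalar_prod u u + l * scalar_prod u a"
    using assms by (simp add: scalar_prod_add_distrib[where n=n])
  also have "scalar_prod (l \<cdot>\<^sub>v a) (u + l \<cdot>\<^sub>v a) = l * scalar_prod u a + l * (l * scalar_prod a a)"
    using assms comm_scalar_prod[OF assms] by (simp add: scalar_prod_add_distrib[where n=n])
  finally show ?thesis by (simp add: power2_eq_square)
qed

text \<open>The Euclidean squared distance of the coordinates, not the gauge distance: along a
  horizontal line it is exactly a quadratic polynomial.\<close>

fun sqdist :: "heis_pt \<Rightarrow> heis_pt \<Rightarrow> real" where
  "sqdist (x, y, t) (x', y', t') = scalar_prod (x - x') (x - x') + scalar_prod (y - y') (y - y') + (t - t')\<^sup>2"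

lemma sqdist_nonneg: "0 \<le> sqdist \<xi> \<eta>"
  by (cases \<xi>; cases \<eta>) (simp add: scalar_prod_self_nonneg)

lemma sqdist_self: "\<xi> \<in> heis n \<Longrightarrow> sqdist \<xi> \<xi> = 0"
  by (cases \<xi>) (auto simp: heis_def)

lemma sqdist_coord_le:
  assumes "(x, y, t) \<in> heis n" "(x', y', t') \<in> heis n"
  shows "i < n \<Longrightarrow> (x $ i - x' $ i)\<^sup>2 \<le> sqdist (x, y, t) (x', y', t')"
    "i < n \<Longrightarrow> (y $ i - y' $ i)\<^sup>2 \<le> sqdist (x, y, t) (x', y', t')"
    "(t - t')\<^sup>2 \<le> sqdist (x, y, t) (x', y', t')"
proof -
  have c: "x \<in> carrier_vec n" "y \<in> carrier_vec n" "x' \<in> carrier_vec n" "y' \<in> carrier_vec n"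
    using assms by (auto simp: heis_def)
  have nn: "0 \<le> scalar_prod (x - x') (x - x')" "0 \<le> scalar_prod (y - y') (y - y')" "0 \<le> (t - t')\<^sup>2"
    by (auto simp: scalar_prod_self_nonneg)
  show "(x $ i - x' $ i)\<^sup>2 \<le> sqdist (x, y, t) (x', y', t')" if "i < n"
  proof -
    have "(x $ i - x' $ i)\<^sup>2 \<le> scalar_prod (x - x') (x - x')"
      using sq_index_le_scalar_prod[of "x - x'" n i] c that by simp
    then show ?thesis unfolding sqdist.simps using nn by linarith
  qed
  show "(y $ i - y' $ i)\<^sup>2 \<le> sqdist (x, y, t) (x', y', t')" if "i < n"
  proof -
    have "(y $ i - y' $ i)\<^sup>2 \<le> scalar_prod (y - y') (y - y')"
      using sq_index_le_scalar_prod[of "y - y'" n i] c that by simp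
    then show ?thesis unfolding sqdist.simps using nn by linarith
  qed
  show "(t - t')\<^sup>2 \<le> sqdist (x, y, t) (x', y', t')" using nn by simp
qed

lemma hconv_sqdist:
  assumes X: "\<And>k. X k \<in> heis n" and \<eta>: "\<eta> \<in> heis n" and \<xi>: "\<xi> \<in> heis n" and conv: "hconv n X \<eta>"
  shows "(\<lambda>k. sqdist (X k) \<xi>) \<longlonglongrightarrow> sqdist \<eta> \<xi>"
proof -
  have e: "sqdist \<zeta> \<xi> = scalar_prod (fst \<zeta> - fst \<xi>) (fst \<zeta> - fst \<xi>)
      + scalar_prod (fst (snd \<zeta>) - fst (snd \<xi>)) (fst (snd \<zeta>) - fst (snd \<xi>)) + (snd (snd \<zeta>) - snd (snd \<xi>))\<^sup>2" for \<zeta>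
    by (cases \<zeta>; cases \<xi>) simp
  have c: "fst \<zeta> \<in> carrier_vec n" "fst (snd \<zeta>) \<in> carrier_vec n" "dim_vec (fst \<zeta>) = n" "dim_vec (fst (snd \<zeta>)) = n"
    if "\<zeta> \<in> heis n" for \<zeta>
    using that by (auto simp: heis_def)
  note cs = c[OF X] c[OF \<eta>] c[OF \<xi>]
  have 1: "(\<lambda>k. (fst (X k) - fst \<xi>) $ i) \<longlonglongrightarrow> (fst \<eta> - fst \<xi>) $ i"
    "(\<lambda>k. (fst (snd (X k)) - fst (snd \<xi>)) $ i) \<longlonglongrightarrow> (fst (snd \<eta>) - fst (snd \<xi>)) $ i" if "i < n" for i
    using conv that by (simp_all add: cs hconv_def tendsto_diff)
  have 2: "(\<lambda>k. snd (snd (X k))) \<longlonglongrightarrow> snd (snd \<eta>)" using conv by (simp add: hconv_def)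
  show ?thesis unfolding e
    by (intro tendsto_add tendsto_power tendsto_diff tendsto_scalar_prod[where n=n] 1 2 tendsto_const)
      (auto simp: cs)
qed

lemma sqdist_hconv:
  assumes X: "\<And>k. X k \<in> heis n" and \<xi>: "\<xi> \<in> heis n" and lim: "(\<lambda>k. sqdist (X k) \<xi>) \<longlonglongrightarrow> 0"
  shows "hconv n X \<xi>"
proof -
  have aux: "u \<longlonglongrightarrow> a" if "\<And>k. (u k - a)\<^sup>2 \<le> sqdist (X k) \<xi>" for u a
  proof -
    have "(\<lambda>k. (u k - a)\<^sup>2) \<longlonglongrightarrow> 0"
      by (rule tendsto_sandwich[OF _ _ tendsto_const lim]) (auto simp: that)
    from tendsto_real_sqrt[OF this] have "(\<lambda>k. \<bar>u k - a\<bar>) \<longlonglongrightarrow> 0" by simp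
    then show ?thesis by (simp add: tendsto_rabs_zero_iff LIM_zero_iff)
  qed
  have "(fst (X k) $ i - fst \<xi> $ i)\<^sup>2 \<le> sqdist (X k) \<xi>" "(fst (snd (X k)) $ i - fst (snd \<xi>) $ i)\<^sup>2 \<le> sqdist (X k) \<xi>"
    if "i < n" for i k
    using sqdist_coord_le(1,2)[of "fst (X k)" "fst (snd (X k))" "snd (snd (X k))" n "fst \<xi>" "fst (snd \<xi>)" "snd (snd \<xi>)" i] X[of k] \<xi> that
    by auto
  moreover have "(snd (snd (X k)) - snd (snd \<xi>))\<^sup>2 \<le> sqdist (X k) \<xi>" for k
    using sqdist_coord_le(3)[of "fst (X k)" "fst (snd (X k))" "snd (snd (X k))" n "fst \<xi>" "fst (snd \<xi>)" "snd (snd \<xi>)"] X[of k] \<xi>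
    by auto
  ultimately show ?thesis unfolding hconv_def by (auto intro!: aux)
qed

lemma sqdist_ball_bounded:
  assumes \<xi>: "\<xi> \<in> heis n"
  obtains r where "\<And>\<eta>. \<eta> \<in> heis n \<Longrightarrow> sqdist \<eta> \<xi> \<le> 1 \<Longrightarrow> \<eta> \<in> hbox n r"
proof -
  obtain r where r: "\<xi> \<in> hbox n r" using hconv_hbox[OF \<xi> \<xi> hconv_const] by blast
  have near: "\<bar>u\<bar> \<le> r + 1" if "(u - v)\<^sup>2 \<le> q" "q \<le> 1" "\<bar>v\<bar> \<le> r" for u v q :: real
  proof -
    have "\<bar>u - v\<bar> \<le> 1" using that(1,2) by (simp flip: abs_square_le_1)
    then show ?thesis using that by linarith
  qed
  show ?thesis
  proof (rule that[of "r + 1"])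
    fix \<eta> assume *: "\<eta> \<in> heis n" "sqdist \<eta> \<xi> \<le> 1"
    obtain x y t x' y' t' where e: "\<eta> = (x, y, t)" "\<xi> = (x', y', t')" by (cases \<eta>; cases \<xi>)
    note co = sqdist_coord_le[OF *(1)[unfolded e] \<xi>[unfolded e]]
    have q: "sqdist (x, y, t) (x', y', t') \<le> 1" using * by (simp add: e)
    show "\<eta> \<in> hbox n (r + 1)"
      unfolding e hbox_def using r *(1) near[OF co(1) q] near[OF co(2) q] near[OF co(3) q]
      by (auto simp: e hbox_def)
  qed
qed

text \<open>The height changes linearly in \<open>l\<close>, so expanding the squares suffices. The
  linear coefficient is itself linear in \<open>(a, b)\<close>, which makes it usable as a
  subgradient.\<close>

lemma sqdist_horizontal:
  assumes \<xi>: "\<xi> = (x, y, t)" "\<xi> \<in> heis n" and \<xi>': "\<xi>' = (x', y', t')" "\<xi>' \<in> heis n"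
    and ab: "a \<in> carrier_vec n" "b \<in> carrier_vec n"
  shows "sqdist (\<xi> \<circ>\<^sub>H (l \<cdot>\<^sub>v a, l \<cdot>\<^sub>v b, 0)) \<xi>' = sqdist \<xi> \<xi>'
    + 2 * l * (scalar_prod ((x - x') + (2 * (t - t')) \<cdot>\<^sub>v y) a + scalar_prod ((y - y') - (2 * (t - t')) \<cdot>\<^sub>v x) b)
    + l\<^sup>2 * (scalar_prod a a + scalar_prod b b + (2 * (scalar_prod a y - scalar_prod x b))\<^sup>2)"
proof -
  have c: "x \<in> carrier_vec n" "y \<in> carrier_vec n" "x' \<in> carrier_vec n" "y' \<in> carrier_vec n"
    using \<xi> \<xi>' by (auto simp: heis_def)
  have 1: "x + l \<cdot>\<^sub>v a - x' = (x - x') + l \<cdot>\<^sub>v a" "y + l \<cdot>\<^sub>v b - y' = (y - y') + l \<cdot>\<^sub>v b"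
    using c ab by (auto intro!: eq_vecI)
  have 2: "scalar_prod ((x - x') + (2 * (t - t')) \<cdot>\<^sub>v y) a = scalar_prod (x - x') a + 2 * (t - t') * scalar_prod y a"
    "scalar_prod ((y - y') - (2 * (t - t')) \<cdot>\<^sub>v x) b = scalar_prod (y - y') b - 2 * (t - t') * scalar_prod x b"
    using c ab by (simp_all add: add_scalar_prod_distrib[where n=n] minus_scalar_prod_distrib[where n=n])
  have 3: "scalar_prod (l \<cdot>\<^sub>v a) y = l * scalar_prod a y" "scalar_prod x (l \<cdot>\<^sub>v b) = l * scalar_prod x b"
    using c ab by auto
  have 4: "scalar_prod y a = scalar_prod a y" using c ab by (intro comm_scalar_prod)
  show ?thesis
    unfolding \<xi> \<xi>' hmult.simps sqdist.simps 1 2 3 4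
      scalar_prod_add_smult_self[OF minus_carrier_vec[OF c(1,3)] ab(1)]
      scalar_prod_add_smult_self[OF minus_carrier_vec[OF c(2,4)] ab(2)]
    by (simp add: power2_eq_square algebra_simps)
qed

context round_at_origin
begin

text \<open>Along a horizontal line, \<open>\<phi>\<close> is convex and touched from below by a quadratic polynomial,
  hence lies above its tangent, whose slope is linear in the direction.\<close>

lemma subdiff_at_minimum:
  assumes \<xi>: "\<xi> \<in> heis n" and \<eta>: "\<eta> \<in> heis n" and k: "0 \<le> k" and interior: "sqdist \<eta> \<xi> < 1"
    and min: "\<And>\<zeta>. \<zeta> \<in> heis n \<Longrightarrow> sqdist \<zeta> \<xi> \<le> 1 \<Longrightarrow> \<phi> \<eta> + k * sqdist \<eta> \<xi> \<le> \<phi> \<zeta> + k * sqdist \<zeta> \<xi>"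
  shows "H_subdiff n \<phi> \<eta> \<noteq> {}"
proof -
  obtain x y t x' y' t' where e: "\<eta> = (x, y, t)" "\<xi> = (x', y', t')" by (cases \<eta>; cases \<xi>)
  have c: "x \<in> carrier_vec n" "y \<in> carrier_vec n" "x' \<in> carrier_vec n" "y' \<in> carrier_vec n"
    using \<xi> \<eta> by (auto simp: e heis_def)
  \<comment> \<open>Together \<open>p\<close> and \<open>q\<close> are half the horizontal gradient
    of the squared distance at \<open>\<eta>\<close>; the subgradient will be their multiple by
    \<open>- 2 * k\<close>.\<close>
  define p where "p = (x - x') + (2 * (t - t')) \<cdot>\<^sub>v y"
  define q where "q = (y - y') - (2 * (t - t')) \<cdot>\<^sub>v x"
  have pq: "p \<in> carrier_vec n" "q \<in> carrier_vec n" using c by (auto simp: p_def q_def)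
  have "\<phi> \<eta> + scalar_prod ((- 2 * k) \<cdot>\<^sub>v p @\<^sub>v (- 2 * k) \<cdot>\<^sub>v q) (a @\<^sub>v b) \<le> \<phi> (\<eta> \<circ>\<^sub>H (a, b, 0))"
    if ab: "a \<in> carrier_vec n" "b \<in> carrier_vec n" for a b
  proof -
    define L where "L = scalar_prod p a + scalar_prod q b"
    define W where "W = scalar_prod a a + scalar_prod b b + (2 * (scalar_prod a y - scalar_prod x b))\<^sup>2"
    let ?\<eta> = "\<lambda>l. \<eta> \<circ>\<^sub>H (l \<cdot>\<^sub>v a, l \<cdot>\<^sub>v b, 0)"
    have sq: "sqdist (?\<eta> l) \<xi> = sqdist \<eta> \<xi> + 2 * l * L + l\<^sup>2 * W" for l
      unfolding L_def W_def p_def q_def by (rule sqdist_horizontal[OF e(1) \<eta> e(2) \<xi> ab])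
    \<comment> \<open>Minimality at the point with parameter \<open>l\<close>, combined with
      convexity and divided by \<open>l\<close>. Letting \<open>l\<close> tend to 0 removes the
      quadratic term; as \<open>\<eta>\<close> is interior, small \<open>l\<close> stay in the
      ball.\<close>
    have bound: "- k * (2 * L + l * W) \<le> \<phi> (\<eta> \<circ>\<^sub>H (a, b, 0)) - \<phi> \<eta>"
      if l: "0 < l" "l < 1" "sqdist \<eta> \<xi> + 2 * l * L + l\<^sup>2 * W \<le> 1" for l
    proof -
      have "?\<eta> l \<in> heis n" using ab by (intro hmult_closed \<eta>) (auto simp: heis_def)
      from min[OF this] have "\<phi> \<eta> + k * sqdist \<eta> \<xi> \<le> \<phi> (?\<eta> l) + k * (sqdist \<eta> \<xi> + 2 * l * L + l\<^sup>2 * W)"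
        using l(3) unfolding sq by simp
      moreover have "\<phi> (?\<eta> l) \<le> (1 - l) * \<phi> \<eta> + l * \<phi> (\<eta> \<circ>\<^sub>H (a, b, 0))"
        using l by (intro hconvex_line[OF convex \<eta> ab]) auto
      ultimately have "l * (- k * (2 * L + l * W)) \<le> l * (\<phi> (\<eta> \<circ>\<^sub>H (a, b, 0)) - \<phi> \<eta>)"
        by (simp add: algebra_simps power2_eq_square)
      then show ?thesis using l(1) by (simp only: mult_le_cancel_left_pos)
    qed
    have lim1: "((\<lambda>l. - k * (2 * L + l * W)) \<longlongrightarrow> - k * (2 * L + 0 * W)) (at_right 0)"
      by (intro tendsto_intros)
    have "((\<lambda>l. sqdist \<eta> \<xi> + 2 * l * L + l\<^sup>2 * W) \<longlongrightarrow> sqdist \<eta> \<xi> + 2 * 0 * L + 0\<^sup>2 * W) (at_right 0)"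
      by (intro tendsto_intros)
    then have "eventually (\<lambda>l. sqdist \<eta> \<xi> + 2 * l * L + l\<^sup>2 * W < 1) (at_right 0)"
      using interior by (intro order_tendstoD) auto
    moreover have "eventually (\<lambda>l. l \<in> {0<..<1}) (at_right (0::real))"
      by (rule eventually_at_right_real) simp
    ultimately have "eventually (\<lambda>l. - k * (2 * L + l * W) \<le> \<phi> (\<eta> \<circ>\<^sub>H (a, b, 0)) - \<phi> \<eta>) (at_right 0)"
      by eventually_elim (use bound in auto)
    from tendsto_upperbound[OF lim1 this] have "- 2 * k * L \<le> \<phi> (\<eta> \<circ>\<^sub>H (a, b, 0)) - \<phi> \<eta>" by simp
    then show ?thesis
      using ab pq by (simp add: scalar_prod_append[of _ n _ n] L_def algebra_simps)
  qed
  moreover have "(- 2 * k) \<cdot>\<^sub>v p @\<^sub>v (- 2 * k) \<cdot>\<^sub>v q \<in> carrier_vec (2 * n)"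
    using append_carrier_vec[of "(- 2 * k) \<cdot>\<^sub>v p" n "(- 2 * k) \<cdot>\<^sub>v q" n] pq unfolding mult_2[of n, symmetric] by simp
  ultimately have "(- 2 * k) \<cdot>\<^sub>v p @\<^sub>v (- 2 * k) \<cdot>\<^sub>v q \<in> H_subdiff n \<phi> \<eta>"
    unfolding H_subdiff_iff[OF \<eta>] by blast
  then show ?thesis by blast
qed

text \<open>A minimising sequence in the ball has a convergent subsequence, and the continuity of
  \<open>\<phi>\<close> makes its limit a minimum point.\<close>

lemma minimum_exists:
  assumes \<xi>: "\<xi> \<in> heis n" and k: "0 \<le> k"
  obtains \<eta> where "\<eta> \<in> heis n" "sqdist \<eta> \<xi> \<le> 1"
    "\<And>\<zeta>. \<zeta> \<in> heis n \<Longrightarrow> sqdist \<zeta> \<xi> \<le> 1 \<Longrightarrow> \<phi> \<eta> + k * sqdist \<eta> \<xi> \<le> \<phi> \<zeta> + k * sqdist \<zeta> \<xi>"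
proof -
  define D where "D = {\<zeta> \<in> heis n. sqdist \<zeta> \<xi> \<le> 1}"
  define f where "f \<zeta> = \<phi> \<zeta> + k * sqdist \<zeta> \<xi>" for \<zeta>
  obtain r where "\<And>\<eta>. \<eta> \<in> heis n \<Longrightarrow> sqdist \<eta> \<xi> \<le> 1 \<Longrightarrow> \<eta> \<in> hbox n r"
    by (rule sqdist_ball_bounded[OF \<xi>]) blast
  then have r: "D \<subseteq> hbox n r" by (auto simp: D_def)
  obtain M where M: "\<And>\<zeta>. \<zeta> \<in> hbox n r \<Longrightarrow> \<bar>\<phi> \<zeta>\<bar> \<le> M" using bounded_box by blast
  have "- M \<le> f \<zeta>" if "\<zeta> \<in> D" for \<zeta>
  proof -
    have "\<bar>\<phi> \<zeta>\<bar> \<le> M" using r that M by blast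
    moreover have "0 \<le> k * sqdist \<zeta> \<xi>" using k sqdist_nonneg by simp
    ultimately show ?thesis unfolding f_def by linarith
  qed
  then have bdd: "bdd_below (f ` D)" by (intro bdd_belowI2)
  have \<xi>D: "\<xi> \<in> D" using \<xi> sqdist_self[OF \<xi>] by (simp add: D_def)
  define m where "m = Inf (f ` D)"
  have m: "m \<le> f \<zeta>" if "\<zeta> \<in> D" for \<zeta> unfolding m_def using bdd that by (intro cInf_lower) auto
  have "\<exists>\<zeta>\<in>D. f \<zeta> < m + 1 / real (Suc j)" for j
    using cInf_lessD[of "f ` D" "m + 1 / real (Suc j)"] \<xi>D unfolding m_def by auto
  then obtain X where X: "\<And>j. X j \<in> D" "\<And>j. f (X j) < m + 1 / real (Suc j)" by metis
  have "\<And>j. X j \<in> hbox n r" using X(1) r by blast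
  then obtain \<sigma> \<eta> where \<sigma>: "strict_mono \<sigma>" and \<eta>: "\<eta> \<in> heis n" and conv: "hconv n (\<lambda>j. X (\<sigma> j)) \<eta>"
    by (rule hbox_compact)
  have Xh: "X j \<in> heis n" for j using X(1)[of j] by (simp add: D_def)
  have lim: "(\<lambda>j. sqdist (X (\<sigma> j)) \<xi>) \<longlonglongrightarrow> sqdist \<eta> \<xi>" by (rule hconv_sqdist[OF Xh \<eta> \<xi> conv])
  have "sqdist \<eta> \<xi> \<le> 1"
    by (rule tendsto_upperbound[OF lim]) (use X(1) in \<open>auto simp: D_def\<close>)
  moreover have "f \<eta> \<le> m"
  proof (rule LIMSEQ_le)
    show "(\<lambda>j. f (X (\<sigma> j))) \<longlonglongrightarrow> f \<eta>"
      unfolding f_def by (intro tendsto_add tendsto_mult tendsto_const lim phi_continuous[OF Xh \<eta> conv])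
    show "(\<lambda>j. m + 1 / real (Suc (\<sigma> j))) \<longlonglongrightarrow> m"
      using tendsto_add[OF tendsto_const[of m] LIMSEQ_subseq_LIMSEQ[OF LIMSEQ_inverse_real_of_nat \<sigma>]]
      by (simp add: o_def divide_inverse)
    show "\<exists>N. \<forall>j\<ge>N. f (X (\<sigma> j)) \<le> m + 1 / real (Suc (\<sigma> j))" using X(2) by (auto intro: less_imp_le)
  qed
  ultimately show ?thesis using m that[OF \<eta>] unfolding D_def f_def by force
qed

text \<open>Comparing the minimum of \<open>\<phi>\<close> plus \<open>k\<close> times the squared
  distance with its value at \<open>\<xi>\<close> shows that the minimum point has squared distance
  at most \<open>2 * M / k\<close> from \<open>\<xi>\<close>.\<close>

lemma subdiff_dense:
  assumes \<xi>: "\<xi> \<in> heis n"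
  obtains X where "\<And>k. X k \<in> heis n" "\<And>k. H_subdiff n \<phi> (X k) \<noteq> {}" "hconv n X \<xi>"
proof -
  obtain r where r: "\<And>\<eta>. \<eta> \<in> heis n \<Longrightarrow> sqdist \<eta> \<xi> \<le> 1 \<Longrightarrow> \<eta> \<in> hbox n r"
    by (rule sqdist_ball_bounded[OF \<xi>]) blast
  obtain M where M: "\<And>\<zeta>. \<zeta> \<in> hbox n r \<Longrightarrow> \<bar>\<phi> \<zeta>\<bar> \<le> M" using bounded_box by blast
  have M0: "0 \<le> M" using M[OF r[OF \<xi>]] sqdist_self[OF \<xi>] by simp
  have "\<exists>\<eta>\<in>heis n. H_subdiff n \<phi> \<eta> \<noteq> {} \<and> sqdist \<eta> \<xi> \<le> 2 * M / real (Suc j)" for j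
  proof -
    \<comment> \<open>The summand \<open>2 * M\<close> leaves room for \<open>2 * M / k < 1\<close>,
      so the minimum point is interior; the summand \<open>real (Suc j)\<close> makes the distance
      tend to 0.\<close>
    define k where "k = 2 * M + real (Suc j)"
    have k: "0 < k" using M0 by (simp add: k_def)
    obtain \<eta> where \<eta>: "\<eta> \<in> heis n" "sqdist \<eta> \<xi> \<le> 1"
      and min: "\<And>\<zeta>. \<zeta> \<in> heis n \<Longrightarrow> sqdist \<zeta> \<xi> \<le> 1 \<Longrightarrow> \<phi> \<eta> + k * sqdist \<eta> \<xi> \<le> \<phi> \<zeta> + k * sqdist \<zeta> \<xi>"
      using minimum_exists[OF \<xi>, of k] k by auto
    have "\<phi> \<eta> + k * sqdist \<eta> \<xi> \<le> \<phi> \<xi>" using min[OF \<xi>] sqdist_self[OF \<xi>] by simp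
    moreover have "\<bar>\<phi> \<eta>\<bar> \<le> M" "\<bar>\<phi> \<xi>\<bar> \<le> M" using M r \<eta> \<xi> sqdist_self[OF \<xi>] by auto
    ultimately have *: "k * sqdist \<eta> \<xi> \<le> 2 * M" by linarith
    then have "sqdist \<eta> \<xi> \<le> 2 * M / k" using k by (simp add: field_simps)
    also have "2 * M / k < 1" using k by (simp add: k_def)
    finally have "H_subdiff n \<phi> \<eta> \<noteq> {}" using k min by (intro subdiff_at_minimum[OF \<xi> \<eta>(1) less_imp_le[OF k]]) auto
    moreover have "real (Suc j) * sqdist \<eta> \<xi> \<le> k * sqdist \<eta> \<xi>"
      using M0 sqdist_nonneg by (intro mult_right_mono) (auto simp: k_def)
    then have "sqdist \<eta> \<xi> \<le> 2 * M / real (Suc j)" using * by (simp add: field_simps)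
    ultimately show ?thesis using \<eta> by blast
  qed
  then obtain X where X: "\<And>j. X j \<in> heis n" "\<And>j. H_subdiff n \<phi> (X j) \<noteq> {}" "\<And>j. sqdist (X j) \<xi> \<le> 2 * M / real (Suc j)"
    by metis
  have "(\<lambda>j. 2 * M / real (Suc j)) \<longlonglongrightarrow> 0"
    using tendsto_mult_right_zero[OF LIMSEQ_inverse_real_of_nat, of "2 * M"] by (simp add: divide_inverse)
  then have "(\<lambda>j. sqdist (X j) \<xi>) \<longlonglongrightarrow> 0"
    by (rule tendsto_sandwich[OF _ _ tendsto_const, rotated 2]) (use X(3) sqdist_nonneg in auto)
  from that[OF X(1,2) sqdist_hconv[OF X(1) \<xi> this]] show ?thesis .
qed

end

section \<open>Doubling along a ray and engulfing\<close>

lemma scalar_prod_append_linear: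
  fixes p :: "real vec"
  assumes "p \<in> carrier_vec (2 * n)" "a \<in> carrier_vec n" "b \<in> carrier_vec n"
  shows "scalar_prod p ((l \<cdot>\<^sub>v a) @\<^sub>v (l \<cdot>\<^sub>v b)) = l * scalar_prod p (a @\<^sub>v b)"
    "scalar_prod p ((- a) @\<^sub>v (- b)) = - scalar_prod p (a @\<^sub>v b)"
proof -
  have c: "a @\<^sub>v b \<in> carrier_vec (2 * n)" using assms by (simp add: mult_2)
  have "(l \<cdot>\<^sub>v a) @\<^sub>v (l \<cdot>\<^sub>v b) = l \<cdot>\<^sub>v (a @\<^sub>v b)" "(- a) @\<^sub>v (- b) = - (a @\<^sub>v b)"
    using assms by (auto intro!: eq_vecI)
  moreover have "dim_vec p = dim_vec (a @\<^sub>v b)" using c assms(1) by (metis carrier_vecD)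
  ultimately show "scalar_prod p ((l \<cdot>\<^sub>v a) @\<^sub>v (l \<cdot>\<^sub>v b)) = l * scalar_prod p (a @\<^sub>v b)"
    "scalar_prod p ((- a) @\<^sub>v (- b)) = - scalar_prod p (a @\<^sub>v b)"
    by simp_all
qed

lemma scalar_prod_Pr1_horizontal:
  assumes "p \<in> carrier_vec (2 * n)" "\<xi> \<in> heis n" "a \<in> carrier_vec n" "b \<in> carrier_vec n"
  shows "scalar_prod p (Pr1 (\<xi> \<circ>\<^sub>H (a, b, 0))) = scalar_prod p (Pr1 \<xi>) + scalar_prod p (a @\<^sub>v b)"
proof -
  have c: "Pr1 \<zeta> \<in> carrier_vec (2 * n)" if "\<zeta> \<in> heis n" for \<zeta>
    using that by (cases \<zeta>) (auto simp: heis_def mult_2)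
  have ab: "a @\<^sub>v b \<in> carrier_vec (2 * n)" using assms by (simp add: mult_2)
  have "Pr1 (\<xi> \<circ>\<^sub>H (a, b, 0)) = Pr1 \<xi> + (a @\<^sub>v b)"
    using assms by (cases \<xi>) (auto simp: heis_def intro!: eq_vecI)
  then show ?thesis using scalar_prod_add_distrib[OF assms(1) c[OF assms(2)] ab] by simp
qed

section \<open>Growth along a ray\<close>

context round_at_origin
begin

lemma shift_line_heis: "\<eta> \<in> heis n \<Longrightarrow> \<eta> \<circ>\<^sub>H (l \<cdot>\<^sub>v e, 0\<^sub>v n, 0) \<in> heis n"
  by (intro hmult_closed) (auto simp: heis_def)

text \<open>A section at \<open>\<eta>\<close> reaching back to distance \<open>h\<close> reaches
  forward to \<open>K0 * h\<close>. Its affine part contributes \<open>(1 + K0) * h\<close> times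
  the slope of the subgradient, and the chord to the point at distance \<open>k\<close> bounds that
  slope, so the subgradient disappears from the estimate.\<close>

lemma four_point_subdiff:
  assumes \<eta>: "\<eta> \<in> heis n" and "H_subdiff n \<phi> \<eta> \<noteq> {}" and h: "0 < h" and k: "0 < k"
  shows "\<phi> (\<eta> \<circ>\<^sub>H ((K0 * h) \<cdot>\<^sub>v e, 0\<^sub>v n, 0)) \<le> \<phi> (\<eta> \<circ>\<^sub>H ((- h) \<cdot>\<^sub>v e, 0\<^sub>v n, 0))
    + (1 + K0) * (h / k) * (\<phi> (\<eta> \<circ>\<^sub>H (k \<cdot>\<^sub>v e, 0\<^sub>v n, 0)) - \<phi> \<eta>)"
proof -
  obtain q where q: "q \<in> H_subdiff n \<phi> \<eta>" using assms by auto
  then have qc: "q \<in> carrier_vec (2 * n)" by (simp add: H_subdiff_def)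
  define m where "m = scalar_prod q (e @\<^sub>v 0\<^sub>v n)"
  define f where "f l = \<phi> (\<eta> \<circ>\<^sub>H (l \<cdot>\<^sub>v e, 0\<^sub>v n, 0))" for l
  have qm: "scalar_prod q ((l \<cdot>\<^sub>v e) @\<^sub>v 0\<^sub>v n) = l * m" for l
  proof -
    have "l \<cdot>\<^sub>v 0\<^sub>v n = 0\<^sub>v n" by (auto intro!: eq_vecI)
    then show ?thesis using scalar_prod_append_linear(1)[OF qc, of e "0\<^sub>v n" l] by (simp add: m_def)
  qed
  have sub: "\<phi> \<eta> + l * m \<le> f l" for l
    using q H_subdiff_iff[OF \<eta>, of q \<phi>] qm[of l] unfolding f_def by (metis smult_carrier_vec unit_vec_carrier zero_carrier_vec)
  have norm: "sqrt (scalar_prod (l \<cdot>\<^sub>v e) (l \<cdot>\<^sub>v e) + scalar_prod (0\<^sub>v n) (0\<^sub>v n)) = \<bar>l\<bar>" for l :: real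
    using n_pos by (simp flip: power2_eq_square)
  have "h / k * (k * m) \<le> h / k * (f k - \<phi> \<eta>)"
    using sub[of k] h k by (intro mult_left_mono) auto
  then have hm: "h * m \<le> h / k * (f k - \<phi> \<eta>)" using k by simp
  have "f (K0 * h) \<le> f (- h) + (1 + K0) * (h * m)"
  proof (rule field_le_epsilon)
    fix \<epsilon> :: real assume \<epsilon>: "0 < \<epsilon>"
    \<comment> \<open>The excess of \<open>f\<close> over its affine minorant at \<open>- h\<close>,
      enlarged by \<open>\<epsilon>\<close> because sections are defined by a strict
      inequality.\<close>
    define \<sigma> where "\<sigma> = f (- h) - \<phi> \<eta> + h * m + \<epsilon>"
    have "\<sigma> > 0" using sub[of "- h"] \<epsilon> by (simp add: \<sigma>_def)
    then obtain R where R: "\<And>l. \<bar>l\<bar> \<le> K0 * R \<Longrightarrow> f l - \<phi> \<eta> - l * m < \<sigma>"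
      "\<And>l. f l - \<phi> \<eta> - l * m < \<sigma> \<Longrightarrow> \<bar>l\<bar> \<le> R"
      using round[unfolded round_H_sections_iff, rule_format, OF \<eta> q, of \<sigma>] norm qm unfolding f_def
      by (metis smult_carrier_vec unit_vec_carrier zero_carrier_vec)
    have "\<bar>- h\<bar> \<le> R" by (rule R(2)) (use \<epsilon> in \<open>simp add: \<sigma>_def\<close>)
    then have "\<bar>K0 * h\<bar> \<le> K0 * R" using K0_pos h by simp
    from R(1)[OF this] show "f (K0 * h) \<le> f (- h) + (1 + K0) * (h * m) + \<epsilon>"
      by (simp add: \<sigma>_def algebra_simps)
  qed
  also have "(1 + K0) * (h * m) \<le> (1 + K0) * (h / k * (f k - \<phi> \<eta>))"
    using hm K0_pos by (intro mult_left_mono) auto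
  finally show ?thesis by (simp add: f_def mult.assoc)
qed

text \<open>Every term is continuous in \<open>\<eta>\<close>, so the inequality extends from the
  dense set to all points.\<close>

lemma four_point:
  assumes \<eta>: "\<eta> \<in> heis n" and h: "0 < h" and k: "0 < k"
  shows "\<phi> (\<eta> \<circ>\<^sub>H ((K0 * h) \<cdot>\<^sub>v e, 0\<^sub>v n, 0)) \<le> \<phi> (\<eta> \<circ>\<^sub>H ((- h) \<cdot>\<^sub>v e, 0\<^sub>v n, 0))
    + (1 + K0) * (h / k) * (\<phi> (\<eta> \<circ>\<^sub>H (k \<cdot>\<^sub>v e, 0\<^sub>v n, 0)) - \<phi> \<eta>)"
proof -
  obtain X where X: "\<And>j. X j \<in> heis n" "\<And>j. H_subdiff n \<phi> (X j) \<noteq> {}" and conv: "hconv n X \<eta>"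
    by (rule subdiff_dense[OF \<eta>]) blast
  have lim: "(\<lambda>j. \<phi> (X j \<circ>\<^sub>H (l \<cdot>\<^sub>v e, 0\<^sub>v n, 0))) \<longlonglongrightarrow> \<phi> (\<eta> \<circ>\<^sub>H (l \<cdot>\<^sub>v e, 0\<^sub>v n, 0))" for l
  proof -
    have "(l \<cdot>\<^sub>v e, 0\<^sub>v n, 0) \<in> heis n" by (simp add: heis_def)
    from hconv_mult[OF X(1) \<eta> conv this this hconv_const] show ?thesis
      by (intro phi_continuous shift_line_heis X(1) \<eta>)
  qed
  show ?thesis
    by (rule LIMSEQ_le[OF lim tendsto_add[OF lim tendsto_mult[OF tendsto_const tendsto_diff[OF lim phi_continuous[OF X(1) \<eta> conv]]]]])
      (use four_point_subdiff[OF X(1) X(2) h k] in auto)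
qed

abbreviation "pt r \<equiv> (r \<cdot>\<^sub>v e, 0\<^sub>v n, 0) :: heis_pt"

lemma pt_heis: "pt r \<in> heis n"
  by (simp add: heis_def)

lemma pt_shift: "pt r \<circ>\<^sub>H pt l = pt (r + l)"
  by (auto intro!: eq_vecI simp: algebra_simps)

lemma doubling:
  assumes r: "0 < r" and M: "\<phi> (pt r) \<le> M"
  shows "\<phi> (pt ((1 + K0) / (1 + K0 / 2) * r)) \<le> 2 * (1 + K0) / K0 * M"
proof -
  \<comment> \<open>The centre for \<open>four_point\<close>: going back by \<open>c\<close> meets
    the origin, going forward by \<open>K0 / 2 * c\<close> meets \<open>r\<close>, and roundness
    reaches \<open>(1 + K0) * c\<close>, beyond \<open>r\<close>.\<close>
  define c where "c = r / (1 + K0 / 2)"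
  have pos: "0 < 1 + K0 / 2" using K0_pos by simp
  have c: "0 < c" using r pos by (simp add: c_def)
  have rc: "c + K0 / 2 * c = r" 
  proof -
    have "c * (1 + K0 / 2) = r" using pos by (simp add: c_def)
    then show ?thesis by (simp add: distrib_left mult.commute)
  qed
  have "\<phi> (pt (c + K0 * c)) \<le> \<phi> (pt 0) + (1 + K0) * (c / (K0 / 2 * c)) * (\<phi> (pt r) - \<phi> (pt c))"
    using four_point[OF pt_heis c, of "K0 / 2 * c" c] c K0_pos unfolding pt_shift rc by simp
  also have "pt 0 = (0\<^sub>v n, 0\<^sub>v n, 0)" by (auto intro!: eq_vecI)
  also have "c / (K0 / 2 * c) = 2 / K0" using c by simp
  finally have "\<phi> (pt (c + K0 * c)) \<le> (1 + K0) * (2 / K0) * (\<phi> (pt r) - \<phi> (pt c))"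
    by (simp add: phi_origin)
  also have "\<dots> \<le> (1 + K0) * (2 / K0) * M"
    using M phi_nonneg[of "c \<cdot>\<^sub>v e" "0\<^sub>v n"] K0_pos by (intro mult_left_mono) auto
  also have "c + K0 * c = (1 + K0) / (1 + K0 / 2) * r" by (simp add: c_def add_divide_distrib distrib_right)
  finally show ?thesis by (simp add: mult.commute)
qed

lemma doubling_iterate:
  assumes r: "0 < r" and M: "\<phi> (pt r) \<le> M"
  shows "\<phi> (pt (((1 + K0) / (1 + K0 / 2)) ^ N * r)) \<le> (2 * (1 + K0) / K0) ^ N * M"
proof (induction N)
  case 0
  then show ?case using M by simp
next
  case (Suc N)
  have "0 < ((1 + K0) / (1 + K0 / 2)) ^ N * r" using K0_pos r by (intro mult_pos_pos zero_less_power divide_pos_pos) auto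
  from doubling[OF this Suc] show ?case by (simp only: power_Suc mult.assoc)
qed

text \<open>The reflected point \<open>2 * x - (x + a)\<close>, and likewise for y, has norm at most
  \<open>3 * R\<close>. The larger section contains a point at distance \<open>G * (K0 * R)\<close>,
  hence the ball of radius \<open>G * K0\<^sup>2 * R\<close>, which is at least
  \<open>3 * R\<close>.\<close>

lemma reflection_in_section:
  assumes s: "0 < s" and N: "3 \<le> ((1 + K0) / (1 + K0 / 2)) ^ N * K0\<^sup>2"
    and c: "x \<in> carrier_vec n" "y \<in> carrier_vec n" "a \<in> carrier_vec n" "b \<in> carrier_vec n"
    and 1: "\<phi> (x, y, 0) < s" and 2: "\<phi> (x + a, y + b, 0) < s"
  shows "\<phi> (x - a, y - b, 0) < ((2 * (1 + K0) / K0) ^ N + 1) * s"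
proof -
  define G where "G = ((1 + K0) / (1 + K0 / 2)) ^ N"
  define C where "C = (2 * (1 + K0) / K0) ^ N"
  have C: "0 < C" unfolding C_def using K0_pos by (intro zero_less_power divide_pos_pos) auto
  have normpt: "sqrt (scalar_prod (l \<cdot>\<^sub>v e) (l \<cdot>\<^sub>v e) + scalar_prod (0\<^sub>v n) (0\<^sub>v n)) = \<bar>l\<bar>" for l :: real
    using n_pos by (simp flip: power2_eq_square)
  obtain R where R: "R > 0"
    and R1: "\<And>x y. x \<in> carrier_vec n \<Longrightarrow> y \<in> carrier_vec n \<Longrightarrow> sqrt (scalar_prod x x + scalar_prod y y) \<le> K0 * R \<Longrightarrow> \<phi> (x, y, 0) < s"
    and R2: "\<And>x y. x \<in> carrier_vec n \<Longrightarrow> y \<in> carrier_vec n \<Longrightarrow> \<phi> (x, y, 0) < s \<Longrightarrow> sqrt (scalar_prod x x + scalar_prod y y) \<le> R"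
    by (rule round_origin[OF s]) blast
  have Cs: "0 < (C + 1) * s" using C s by simp
  obtain R' where
        R'1: "\<And>x y. x \<in> carrier_vec n \<Longrightarrow> y \<in> carrier_vec n \<Longrightarrow> sqrt (scalar_prod x x + scalar_prod y y) \<le> K0 * R' \<Longrightarrow> \<phi> (x, y, 0) < (C + 1) * s"
    and R'2: "\<And>x y. x \<in> carrier_vec n \<Longrightarrow> y \<in> carrier_vec n \<Longrightarrow> \<phi> (x, y, 0) < (C + 1) * s \<Longrightarrow> sqrt (scalar_prod x x + scalar_prod y y) \<le> R'"
    by (rule round_origin[OF Cs]) blast
  have KR: "0 < K0 * R" using K0_pos R by simp
  have "\<phi> (pt (K0 * R)) < s" by (rule R1) (use KR normpt[of "K0 * R"] in simp_all)
  then have "\<phi> (pt (G * (K0 * R))) \<le> C * s" unfolding G_def C_def by (intro doubling_iterate KR) simp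
  \<comment> \<open>The additional \<open>s\<close> turns the estimate into the strict inequality
    required by a section.\<close>
  then have "\<phi> (pt (G * (K0 * R))) < (C + 1) * s" using s by (simp add: distrib_right)
  from R'2[OF _ _ this] have "\<bar>G * (K0 * R)\<bar> \<le> R'" unfolding normpt by simp
  then have "K0 * (G * (K0 * R)) \<le> K0 * R'" using K0_pos by simp
  moreover have "3 * R \<le> (G * K0\<^sup>2) * R" using N R by (intro mult_right_mono) (auto simp: G_def)
  ultimately have big: "3 * R \<le> K0 * R'" by (simp add: power2_eq_square mult_ac)
  \<comment> \<open>The difference of the two sides is twice the square of
    \<open>v + 2 \<cdot>\<^sub>v u\<close>. The weights 6 and 3 add up to 9, which gives the radius
    \<open>3 * R\<close> after summing over both components.\<close>
  have sq: "scalar_prod (u - v) (u - v) \<le> 6 * scalar_prod u u + 3 * scalar_prod (u + v) (u + v)"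
    if "u \<in> carrier_vec n" "v \<in> carrier_vec n" for u v :: "real vec"
  proof -
    have "u - v = u + (- 1) \<cdot>\<^sub>v v" "u + v = u + 1 \<cdot>\<^sub>v v" using that by (auto intro!: eq_vecI)
    then have "scalar_prod (u - v) (u - v) = scalar_prod u u - 2 * scalar_prod u v + scalar_prod v v"
      "scalar_prod (u + v) (u + v) = scalar_prod u u + 2 * scalar_prod u v + scalar_prod v v"
      using scalar_prod_add_smult_self[OF that, of "- 1"] scalar_prod_add_smult_self[OF that, of 1] by simp_all
    moreover have "0 \<le> scalar_prod v v + 4 * scalar_prod u v + 4 * scalar_prod u u"
      using scalar_prod_self_nonneg[of "v + 2 \<cdot>\<^sub>v u"] comm_scalar_prod[OF that] scalar_prod_add_smult_self[OF that(2,1), of 2]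
      by simp
    ultimately show ?thesis by linarith
  qed
  have le: "scalar_prod u u + scalar_prod v v \<le> R\<^sup>2" if "sqrt (scalar_prod u u + scalar_prod v v) \<le> R" for u v :: "real vec"
    using that by (rule sqrt_le_D)
  have "scalar_prod (x - a) (x - a) + scalar_prod (y - b) (y - b) \<le> 6 * R\<^sup>2 + 3 * R\<^sup>2"
    using sq[OF c(1,3)] sq[OF c(2,4)] le[OF R2[OF c(1,2) 1]] le[OF R2[OF _ _ 2]] c by auto
  also have "\<dots> = (3 * R)\<^sup>2" by (simp add: power2_eq_square)
  finally have "sqrt (scalar_prod (x - a) (x - a) + scalar_prod (y - b) (y - b)) \<le> 3 * R"
    using R by (intro real_le_lsqrt) auto
  then show ?thesis unfolding C_def[symmetric] using c big by (intro R'1) auto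
qed

end

section \<open>Translation to the origin, and engulfing\<close>

text \<open>Left translation preserves horizontal lines and their displacements. Subtracting the
  affine function of \<open>p\<close> preserves convexity and moves every subgradient by
  \<open>p\<close>, so sections are translated without changing height.\<close>

lemma round_at_origin_translate:
  assumes n: "1 \<le> n" and K0: "0 < K0" and convex: "H_convex n \<phi>" and round: "round_H_sections n \<phi> K0"
    and \<xi>: "\<xi> \<in> heis n" and p: "p \<in> H_subdiff n \<phi> \<xi>"
  shows "round_at_origin n (\<lambda>\<zeta>. \<phi> (\<xi> \<circ>\<^sub>H \<zeta>) - \<phi> \<xi> - scalar_prod p (Pr1 \<zeta>)) K0"
    (is "round_at_origin n ?\<psi> K0")
proof
  have pc: "p \<in> carrier_vec (2 * n)" using p by (simp add: H_subdiff_def)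
  have h: "(a, b, 0) \<in> heis n" if "a \<in> carrier_vec n" "b \<in> carrier_vec n" for a b
    using that by (simp add: heis_def)
  have \<psi>: "?\<psi> (\<zeta> \<circ>\<^sub>H (a, b, 0)) = \<phi> (\<xi> \<circ>\<^sub>H \<zeta> \<circ>\<^sub>H (a, b, 0)) - \<phi> \<xi> - (scalar_prod p (Pr1 \<zeta>) + scalar_prod p (a @\<^sub>v b))"
    if "\<zeta> \<in> heis n" "a \<in> carrier_vec n" "b \<in> carrier_vec n" for \<zeta> a b
    using that by (simp add: scalar_prod_Pr1_horizontal[OF pc] hmult_assoc[OF \<xi> _ h] del: hmult.simps)
  show "1 \<le> n" "0 < K0" by (rule n K0)+
  show "H_convex n ?\<psi>"
    unfolding H_convex_iff
  proof (intro ballI)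
    fix \<zeta> and a b :: "real vec" and l :: real
    assume \<zeta>: "\<zeta> \<in> heis n" and ab: "a \<in> carrier_vec n" "b \<in> carrier_vec n" and l: "l \<in> {0..1}"
    have la: "l \<cdot>\<^sub>v a \<in> carrier_vec n" "l \<cdot>\<^sub>v b \<in> carrier_vec n" using ab by auto
    have "\<phi> (\<xi> \<circ>\<^sub>H \<zeta> \<circ>\<^sub>H (l \<cdot>\<^sub>v a, l \<cdot>\<^sub>v b, 0)) \<le> (1 - l) * \<phi> (\<xi> \<circ>\<^sub>H \<zeta>) + l * \<phi> (\<xi> \<circ>\<^sub>H \<zeta> \<circ>\<^sub>H (a, b, 0))"
      using l by (intro hconvex_line[OF convex hmult_closed[OF \<xi> \<zeta>] ab]) auto
    then show "?\<psi> (\<zeta> \<circ>\<^sub>H (l \<cdot>\<^sub>v a, l \<cdot>\<^sub>v b, 0)) \<le> (1 - l) * ?\<psi> \<zeta> + l * ?\<psi> (\<zeta> \<circ>\<^sub>H (a, b, 0))"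
      unfolding \<psi>[OF \<zeta> ab] \<psi>[OF \<zeta> la] scalar_prod_append_linear(1)[OF pc ab] by (simp add: algebra_simps)
  qed
  show "round_H_sections n ?\<psi> K0"
    unfolding round_H_sections_iff
  proof (intro ballI allI impI)
    fix \<zeta> q and s :: real
    assume \<zeta>: "\<zeta> \<in> heis n" and q: "q \<in> H_subdiff n ?\<psi> \<zeta>" and s: "0 < s"
    have qc: "q \<in> carrier_vec (2 * n)" using q by (simp add: H_subdiff_def)
    have qp: "scalar_prod (q + p) (a @\<^sub>v b) = scalar_prod q (a @\<^sub>v b) + scalar_prod p (a @\<^sub>v b)"
      if "a \<in> carrier_vec n" "b \<in> carrier_vec n" for a b
      using that by (intro add_scalar_prod_distrib[OF qc pc]) (simp add: mult_2)
    have eq: "?\<psi> (\<zeta> \<circ>\<^sub>H (a, b, 0)) - ?\<psi> \<zeta> - scalar_prod q (a @\<^sub>v b)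
        = \<phi> (\<xi> \<circ>\<^sub>H \<zeta> \<circ>\<^sub>H (a, b, 0)) - \<phi> (\<xi> \<circ>\<^sub>H \<zeta>) - scalar_prod (q + p) (a @\<^sub>v b)"
      if "a \<in> carrier_vec n" "b \<in> carrier_vec n" for a b
      unfolding \<psi>[OF \<zeta> that] qp[OF that] by simp
    have "q + p \<in> H_subdiff n \<phi> (\<xi> \<circ>\<^sub>H \<zeta>)"
      unfolding H_subdiff_iff[OF hmult_closed[OF \<xi> \<zeta>]]
    proof (intro conjI ballI)
      show "q + p \<in> carrier_vec (2 * n)" using qc pc by simp
      fix a b :: "real vec" assume ab: "a \<in> carrier_vec n" "b \<in> carrier_vec n"
      have "?\<psi> \<zeta> + scalar_prod q (a @\<^sub>v b) \<le> ?\<psi> (\<zeta> \<circ>\<^sub>H (a, b, 0))"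
        using q ab unfolding H_subdiff_iff[OF \<zeta>] by blast
      with eq[OF ab] show "\<phi> (\<xi> \<circ>\<^sub>H \<zeta>) + scalar_prod (q + p) (a @\<^sub>v b) \<le> \<phi> (\<xi> \<circ>\<^sub>H \<zeta> \<circ>\<^sub>H (a, b, 0))"
        by linarith
    qed
    from round[unfolded round_H_sections_iff, rule_format, OF hmult_closed[OF \<xi> \<zeta>] this s]
    show "\<exists>R>0. \<forall>a\<in>carrier_vec n. \<forall>b\<in>carrier_vec n.
       (sqrt (scalar_prod a a + scalar_prod b b) \<le> K0 * R \<longrightarrow> ?\<psi> (\<zeta> \<circ>\<^sub>H (a, b, 0)) - ?\<psi> \<zeta> - scalar_prod q (a @\<^sub>v b) < s) \<and>
       (?\<psi> (\<zeta> \<circ>\<^sub>H (a, b, 0)) - ?\<psi> \<zeta> - scalar_prod q (a @\<^sub>v b) < s \<longrightarrow> sqrt (scalar_prod a a + scalar_prod b b) \<le> R)"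
      by (simp only: eq cong: ball_cong)
  qed
  show "?\<psi> (0\<^sub>v n, 0\<^sub>v n, 0) = 0"
  proof -
    have "\<xi> \<circ>\<^sub>H (0\<^sub>v n, 0\<^sub>v n, 0) = \<xi>" using \<xi> by (cases \<xi>) (auto simp: heis_def)
    moreover have "Pr1 (0\<^sub>v n, 0\<^sub>v n, 0) = 0\<^sub>v (2 * n)" by (auto simp: mult_2 intro!: eq_vecI)
    ultimately show ?thesis using pc by simp
  qed
  show "0 \<le> ?\<psi> (x, y, 0)" if "x \<in> carrier_vec n" "y \<in> carrier_vec n" for x y
    using p that H_subdiff_iff[OF \<xi>, of p \<phi>] by (fastforce simp del: hmult.simps)
qed

text \<open>The subgradient inequality at \<open>\<xi>'\<close>, tested at the reflection of
  \<open>\<eta>\<close>, bounds the excess at \<open>\<eta>\<close> by a second difference of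
  \<open>\<phi>\<close> centred at \<open>\<xi>'\<close>. Affine functions drop out of it, so it may
  be computed with the normalised function.\<close>

lemma engulfing_of_round:
  assumes n: "1 \<le> n" and K0: "0 < K0" and convex: "H_convex n \<phi>" and round: "round_H_sections n \<phi> K0"
    and N: "3 \<le> ((1 + K0) / (1 + K0 / 2)) ^ N * K0\<^sup>2"
  shows "H_engulfing n \<phi> ((2 * (1 + K0) / K0) ^ N + 2)"
  unfolding H_engulfing_def
proof (intro ballI allI impI subsetI)
  fix \<xi> p \<xi>' q \<eta> and s :: real
  assume \<xi>: "\<xi> \<in> heis n" and p: "p \<in> H_subdiff n \<phi> \<xi>" and s: "0 < s"
    and \<xi>'S: "\<xi>' \<in> H_section n \<phi> \<xi> p s" and q: "q \<in> H_subdiff n \<phi> \<xi>'"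
    and \<eta>S: "\<eta> \<in> H_section n \<phi> \<xi> p s \<inter> hplane n \<xi>'"
  let ?\<psi> = "\<lambda>\<zeta>. \<phi> (\<xi> \<circ>\<^sub>H \<zeta>) - \<phi> \<xi> - scalar_prod p (Pr1 \<zeta>)"
  interpret round_at_origin n ?\<psi> K0 by (rule round_at_origin_translate[OF n K0 convex round \<xi> p])
  have pc: "p \<in> carrier_vec (2 * n)" using p by (simp add: H_subdiff_def)
  have qc: "q \<in> carrier_vec (2 * n)" using q by (simp add: H_subdiff_def)
  have sec: "\<xi> \<circ>\<^sub>H (u, v, 0) \<in> H_section n \<phi> \<xi> p s \<longleftrightarrow> ?\<psi> (u, v, 0) < s" if "u \<in> carrier_vec n" "v \<in> carrier_vec n" for u v
    using H_section_iff[OF \<xi> that] by (simp del: hmult.simps)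
  obtain x y where xy: "x \<in> carrier_vec n" "y \<in> carrier_vec n" and \<xi>'eq: "\<xi>' = \<xi> \<circ>\<^sub>H (x, y, 0)"
    using \<xi>'S hplane_iff[OF \<xi>] by (auto simp: H_section_def simp del: hmult.simps)
  have hxy: "(x, y, 0) \<in> heis n" using xy by (simp add: heis_def)
  have \<xi>': "\<xi>' \<in> heis n" unfolding \<xi>'eq by (rule hmult_closed[OF \<xi> hxy])
  obtain a b where ab: "a \<in> carrier_vec n" "b \<in> carrier_vec n" and \<eta>eq: "\<eta> = \<xi>' \<circ>\<^sub>H (a, b, 0)"
    using \<eta>S hplane_iff[OF \<xi>'] by blast
  obtain u v where uv: "u \<in> carrier_vec n" "v \<in> carrier_vec n" and \<eta>uv: "\<eta> = \<xi> \<circ>\<^sub>H (u, v, 0)"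
    using \<eta>S hplane_iff[OF \<xi>] by (auto simp: H_section_def simp del: hmult.simps)
  have hab: "(a, b, 0) \<in> heis n" "(- a, - b, 0) \<in> heis n" "(u, v, 0) \<in> heis n" using ab uv by (auto simp: heis_def)
  have "\<xi> \<circ>\<^sub>H ((x, y, 0) \<circ>\<^sub>H (a, b, 0)) = \<xi> \<circ>\<^sub>H (u, v, 0)"
    using \<eta>eq \<eta>uv unfolding \<xi>'eq hmult_assoc[OF \<xi> hxy hab(1)] by simp
  then have "(x, y, 0) \<circ>\<^sub>H (a, b, 0) = (u, v, 0)"
    using horizontal_cancel[OF \<xi> hmult_closed[OF hxy hab(1)] hab(3)] by simp
  \<comment> \<open>\<open>flat\<close> is the condition that \<open>\<xi>'\<close> and
    \<open>\<eta>\<close> are horizontally related within the plane of \<open>\<xi>\<close>. It is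
    invariant under changing the signs of \<open>a\<close> and \<open>b\<close>, so the reflection
    also stays in that plane.\<close>
  then have u: "u = x + a" "v = y + b" and flat: "scalar_prod a y = scalar_prod x b" by auto
  have refl: "(x, y, 0) \<circ>\<^sub>H (- a, - b, 0) = (x - a, y - b, 0)"
    using xy ab flat by (auto intro!: eq_vecI)
  have 1: "?\<psi> (x, y, 0) < s" using \<xi>'S sec[OF xy] unfolding \<xi>'eq by simp
  have 2: "?\<psi> (x + a, y + b, 0) < s" using \<eta>S sec[OF uv] unfolding \<eta>uv u by simp
  have 3: "?\<psi> (x - a, y - b, 0) < ((2 * (1 + K0) / K0) ^ N + 1) * s"
    by (rule reflection_in_section[OF s N xy ab 1 2])
  have 4: "0 \<le> ?\<psi> (x, y, 0)" by (rule phi_nonneg[OF xy])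
  have \<psi>1: "?\<psi> (x + a, y + b, 0) = \<phi> \<eta> - \<phi> \<xi> - (scalar_prod p (x @\<^sub>v y) + scalar_prod p (a @\<^sub>v b))"
    using scalar_prod_Pr1_horizontal[OF pc hxy ab] flat unfolding \<eta>uv u by simp
  have mab: "- a \<in> carrier_vec n" "- b \<in> carrier_vec n" using ab by auto
  have \<psi>2: "?\<psi> (x - a, y - b, 0) = \<phi> (\<xi>' \<circ>\<^sub>H (- a, - b, 0)) - \<phi> \<xi> - (scalar_prod p (x @\<^sub>v y) - scalar_prod p (a @\<^sub>v b))"
    using scalar_prod_Pr1_horizontal[OF pc hxy mab] unfolding refl \<xi>'eq hmult_assoc[OF \<xi> hxy hab(2)] scalar_prod_append_linear(2)[OF pc ab]
    by simp
  have \<psi>0: "?\<psi> (x, y, 0) = \<phi> \<xi>' - \<phi> \<xi> - scalar_prod p (x @\<^sub>v y)" by (simp add: \<xi>'eq del: hmult.simps)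
  have "\<phi> \<xi>' - scalar_prod q (a @\<^sub>v b) \<le> \<phi> (\<xi>' \<circ>\<^sub>H (- a, - b, 0))"
    using q mab scalar_prod_append_linear(2)[OF qc ab] unfolding H_subdiff_iff[OF \<xi>'] by fastforce
  \<comment> \<open>The second difference is the normalised value at \<open>\<eta>\<close>, below
    \<open>s\<close>, plus that at the reflection, minus twice the nonnegative value at
    \<open>\<xi>'\<close>.\<close>
  then have "\<phi> \<eta> - \<phi> \<xi>' - scalar_prod q (a @\<^sub>v b) < s + ((2 * (1 + K0) / K0) ^ N + 1) * s"
    using 2 3 4 unfolding \<psi>0 \<psi>1 \<psi>2 by linarith
  also have "\<dots> = ((2 * (1 + K0) / K0) ^ N + 2) * s" by (simp add: algebra_simps)
  finally have "\<eta> \<in> H_section n \<phi> \<xi>' q (((2 * (1 + K0) / K0) ^ N + 2) * s)"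
    unfolding \<eta>eq H_section_iff[OF \<xi>' ab] .
  moreover have "\<eta> \<in> hplane n \<xi>" using \<eta>S by (auto simp: H_section_def)
  ultimately show "\<eta> \<in> H_section n \<phi> \<xi>' q (((2 * (1 + K0) / K0) ^ N + 2) * s) \<inter> hplane n \<xi>" by blast
qed

theorem theorem4p1:
  fixes K0 :: real
  assumes "0 < K0" and "K0 < 1"
  shows "\<exists>K>1. \<forall>n\<ge>1. \<forall>\<phi>. H_convex n \<phi> \<longrightarrow> round_H_sections n \<phi> K0 \<longrightarrow> H_engulfing n \<phi> K"
proof -
  have "1 < (1 + K0) / (1 + K0 / 2)" using assms by (simp add: less_divide_eq)
  \<comment> \<open>\<open>N\<close> depends on \<open>K0\<close> alone, so the constant is fixed
    before \<open>n\<close> and \<open>\<phi>\<close>. The factor 3 pays for the reflection, the two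
    factors \<open>K0\<close> for one use of roundness in each of the two sections.\<close>
  then obtain N where "3 / K0\<^sup>2 < ((1 + K0) / (1 + K0 / 2)) ^ N" using real_arch_pow by blast
  then have N: "3 \<le> ((1 + K0) / (1 + K0 / 2)) ^ N * K0\<^sup>2" using assms by (simp add: divide_less_eq)
  have "0 \<le> (2 * (1 + K0) / K0) ^ N" using assms by simp
  then show ?thesis using engulfing_of_round[OF _ assms(1) _ _ N] by (intro exI[of _ "(2 * (1 + K0) / K0) ^ N + 2"]) auto
qed

end
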